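(* Let $D$ be a noncommutative division ring with $\operatorname{char} D\neq 2$. Let $f,g\colon D\to D$ be additive maps satisfying $f(x)=x^n g(x^{-1})$ for all $x\in D^{\times}$, where $n\neq 2$ is a positive integer. Then $f=0$ and $g=0$.
   Context: Rings are associative with unity. $D^{\times}$ denotes the set of units (nonzero elements) of $D$. *)

theory Defs
  imports Complex_Main
begin

end

theory Submission
  imports Defs "HOL-Computational_Algebra.Primes" "HOL-Library.FuncSet"
begin

text \<open>Replacing \<open>x\<close> by \<open>- x\<close> gives \<open>2 f = 0\<close> when \<open>n\<close> is odd, so let \<open>n \<ge> 4\<close> be even. Write
\<open>T x = (1 + x)\<^sup>n - x\<^sup>n - 1\<close>. If \<open>x\<close> and \<open>w\<close> commute, the inverse of \<open>x + x x w\<close> is the difference of the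
inverses of \<open>x\<close> and of \<open>x + w\<inverse>\<close>, and the hypothesis turns this into
\<open>f (x x w) = T (x w) f x - x\<^sup>n g w\<close> (\<open>reciprocal_identity\<close>). For \<open>x = 1\<close> it reads \<open>f w + g w = T w (f 1)\<close>.
Hence if \<open>T\<close> is not additive, then \<open>f 1 = 0\<close>, \<open>g = - f\<close> and \<open>f (x x) = T x (f x)\<close>. Two claims
remain: \<open>T\<close> is not additive, and an additive \<open>f\<close> with the last properties is zero. On fields of
characteristic \<open>p\<close> both can fail when \<open>n = p\<^sup>a + p\<^sup>b\<close>, since \<open>T x\<close> is then \<open>x ^ p\<^sup>a + x ^ p\<^sup>b\<close> and
\<open>x ^ p\<^sup>a - x ^ p\<^sup>b\<close> is a possible \<open>f\<close>; this is where noncommutativity enters. The condition \<open>n \<noteq> 2\<close>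
enters because \<open>T x = 2 x\<close> for \<open>n = 2\<close>, whereas for even \<open>n \<ge> 4\<close> some coefficient \<open>n choose k\<close> of \<open>T\<close>
with \<open>2 \<le> k < n\<close> is nonzero in \<open>D\<close>.

Suppose that the centre is finite. By an argument in the style of Wedderburn and Jacobson there is an
element \<open>t\<close> of infinite order (\<open>exists_infinite_order\<close>), and its powers are linearly independent over
the centre. With such a \<open>t\<close> a factor \<open>x\<close> on the left can be cancelled: if \<open>F\<close> is a map of bounded
degree, in the sense of iterated differences, and \<open>x F x\<close> has degree at most \<open>e\<close>, then \<open>F\<close> has degree
at most \<open>e - 1\<close> (\<open>degree_less_cancel_id_mult\<close>). Both claims follow by stripping factors \<open>x\<close> from \<open>T x\<close>
and from \<open>T x (f x)\<close>, maps whose degrees are at most one and two although \<open>T\<close> has more terms: the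
coefficients of the higher terms must vanish.

Suppose that the centre is infinite. Then identities that are polynomial in a central variable \<open>z\<close>
can be compared coefficient by coefficient (\<open>central_vandermonde\<close>). If \<open>T\<close> is additive, the commutator
of \<open>T x\<close> and \<open>y\<close> equals that of \<open>x\<close> and \<open>T y\<close>, so it is linear in \<open>z\<close> when \<open>x\<close> is scaled by \<open>z\<close>; this
forces every \<open>x\<^sup>k\<close> to be central. In the
second claim the coefficient of \<open>z\<close> in \<open>f ((u + z v)\<^sup>2)\<close> shows that \<open>T u\<close>, and after scaling \<open>u\<^sup>k\<close>, is
central whenever \<open>f u \<noteq> 0\<close>. Central powers on such large sets are impossible (\<open>no_central_powers\<close>):
they produce a \<open>Y\<close> conjugate to \<open>Y + 1\<close> for which \<open>Y\<^sup>k\<close> and \<open>(Y + 1)\<^sup>k = Y\<^sup>k + 1\<close> are the same central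
element.\<close>

section \<open>Central elements\<close>

definition central :: "'a::ring_1 \<Rightarrow> bool" where
  "central z \<longleftrightarrow> (\<forall>x. z * x = x * z)"

lemma centralD: "central z \<Longrightarrow> z * x = x * z"
  by (simp add: central_def)

lemma central_0 [simp]: "central 0" and central_1 [simp]: "central 1"
  and central_of_nat [simp]: "central (of_nat m)"
  by (simp_all add: central_def mult_of_nat_commute)

lemma central_add: "central z \<Longrightarrow> central w \<Longrightarrow> central (z + w)"
  and central_diff: "central z \<Longrightarrow> central w \<Longrightarrow> central (z - w)"
  by (simp_all add: central_def algebra_simps)

lemma central_mult: "central z \<Longrightarrow> central w \<Longrightarrow> central (z * w)"
  unfolding central_def by (metis mult.assoc)

lemma central_power: "central z \<Longrightarrow> central (z ^ m)"
  by (induction m) (simp_all add: central_mult)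

lemma central_inverse:
  fixes z :: "'a::division_ring"
  shows "central z \<Longrightarrow> central (inverse z)"
  unfolding central_def by (metis inverse_zero mult_commute_imp_mult_inverse_commute)

lemma central_left_commute: "central z \<Longrightarrow> x * (z * y) = z * (x * y)"
  using centralD[of z x] by (simp flip: mult.assoc)

lemma central_mult_power: "central z \<Longrightarrow> (z * x) ^ m = z ^ m * x ^ m"
proof (induction m)
  case (Suc m)
  then show ?case using central_left_commute[OF central_power[OF Suc.prems], of x m]
    by (simp add: mult.assoc)
qed simp

section \<open>Binomial expansions and the middle terms\<close>

lemma power_mult_commuting:
  fixes x y :: "'a::monoid_mult"
  assumes "x * y = y * x" shows "(x * y) ^ k = x ^ k * y ^ k"
proof (induction k)
  case (Suc k)
  have "y * x ^ k = x ^ k * y" using power_commuting_commutes[OF assms, of k] by simp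
  with Suc show ?case by (simp add: mult.assoc) (simp flip: mult.assoc)
qed simp

lemma binomial_commuting:
  fixes x y :: "'a::ring_1"
  assumes xy: "x * y = y * x"
  shows "(x + y) ^ n = (\<Sum>k\<le>n. of_nat (n choose k) * x ^ k * y ^ (n - k))"
proof (induction n)
  case 0 then show ?case by simp
next
  case (Suc n)
  let ?b = "\<lambda>m k. of_nat (m choose k) * x ^ k * y ^ (m - k)"
  have x: "x * ?b n k = of_nat (n choose k) * x ^ Suc k * y ^ (n - k)" for k
    using mult_of_nat_commute[of "n choose k" x] by (simp flip: mult.assoc)
  have yx: "y * x ^ k = x ^ k * y" for k
    using power_commuting_commutes[OF xy] by simp
  have y: "y * ?b n k = of_nat (n choose k) * x ^ k * y ^ (Suc n - k)" if "k \<le> n" for k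
  proof -
    have "y * ?b n k = of_nat (n choose k) * (y * x ^ k) * y ^ (n - k)"
      using mult_of_nat_commute[of "n choose k" y] by (simp flip: mult.assoc)
    also have "\<dots> = of_nat (n choose k) * x ^ k * (y * y ^ (n - k))"
      by (simp add: yx mult.assoc)
    finally show ?thesis using that by (simp add: Suc_diff_le)
  qed
  have "(x + y) ^ Suc n = (\<Sum>k\<le>n. x * ?b n k) + (\<Sum>k\<le>n. y * ?b n k)"
    by (simp add: Suc.IH distrib_right sum_distrib_left sum.distrib)
  also have "(\<Sum>k\<le>n. y * ?b n k) = (\<Sum>k\<le>Suc n. of_nat (n choose k) * x ^ k * y ^ (Suc n - k))"
    using y by (simp add: binomial_eq_0)
  also have "\<dots> = y ^ Suc n + (\<Sum>k\<le>n. of_nat (n choose Suc k) * x ^ Suc k * y ^ (n - k))"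
    by (subst sum.atMost_Suc_shift) simp
  also have "(\<Sum>k\<le>n. x * ?b n k) + \<dots>
      = y ^ Suc n + (\<Sum>k\<le>n. ?b (Suc n) (Suc k))"
    by (simp only: x binomial_Suc_Suc of_nat_add distrib_right sum.distrib diff_Suc_Suc add_ac)
  also have "\<dots> = (\<Sum>k\<le>Suc n. ?b (Suc n) k)"
    by (subst sum.atMost_Suc_shift) simp
  finally show ?case .
qed

abbreviation middle_terms :: "nat \<Rightarrow> 'a::ring_1 \<Rightarrow> 'a" where
  "middle_terms n x \<equiv> (1 + x) ^ n - x ^ n - 1"

lemma middle_terms_eq_sum:
  fixes x :: "'a::ring_1"
  assumes "n > 0"
  shows "middle_terms n x = (\<Sum>i\<in>{1..<n}. of_nat (n choose i) * x ^ i)"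
proof -
  have "(1 + x) ^ n = (\<Sum>i\<le>n. of_nat (n choose i) * x ^ i)"
    using binomial_commuting[of x 1 n] by (simp add: add.commute)
  also have "{..n} = insert 0 (insert n {1..<n})" using assms by auto
  finally show ?thesis using assms by simp
qed

text \<open>If \<open>n \<noteq> 0\<close> in the ring, take \<open>k = n - 1\<close>. Otherwise, if all middle coefficients vanished, evaluating
\<open>(1 + x)\<^sup>n = 1 + x\<^sup>n\<close> at \<open>- 1\<close> would give \<open>0 = 2\<close>.\<close>

lemma exists_middle_binomial_nonzero:
  assumes "even n" "n > 2" "(2::'a::ring_1) \<noteq> 0"
  shows "\<exists>k\<ge>2. k < n \<and> (of_nat (n choose k) :: 'a) \<noteq> 0"
proof (cases "(of_nat n :: 'a) = 0")
  case False
  have "n choose (n - 1) = n" using assms(2) by (cases n) auto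
  with False assms(2) show ?thesis by (intro exI[of _ "n - 1"]) auto
next
  case True
  show ?thesis
  proof (rule ccontr)
    assume none: "\<not> ?thesis"
    have "(of_nat (n choose i) :: 'a) = 0" if "i \<in> {1..<n}" for i
      using that True none by (cases "i = 1") auto
    then have "middle_terms n (-1::'a) = 0"
      using assms(2) by (subst middle_terms_eq_sum) auto
    with assms show False by (simp add: power_0_left)
  qed
qed

lemma middle_terms_commute: "(middle_terms n x) * x = x * (middle_terms n x :: 'a::ring_1)"
proof -
  have "(1 + x) ^ n * x = x * (1 + x) ^ n"
    by (intro power_commuting_commutes) (simp add: algebra_simps)
  then show ?thesis by (simp add: algebra_simps power_commutes)
qed

lemma middle_terms_central_mult:
  fixes z x :: "'a::ring_1"
  assumes "central z" "n > 0"
  shows "middle_terms n (z * x) = (\<Sum>i\<le>n. z ^ i * (if i \<in> {1..<n} then of_nat (n choose i) * x ^ i else 0))"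
proof -
  have "middle_terms n (z * x) = (\<Sum>i\<in>{1..<n}. z ^ i * (of_nat (n choose i) * x ^ i))"
    unfolding middle_terms_eq_sum[OF assms(2)]
    by (simp only: central_mult_power[OF assms(1)] central_left_commute[OF central_power[OF assms(1)]])
  also have "\<dots> = (\<Sum>i\<le>n. z ^ i * (if i \<in> {1..<n} then of_nat (n choose i) * x ^ i else 0))"
    by (intro sum.mono_neutral_cong_left) auto
  finally show ?thesis .
qed

section \<open>Maps of bounded degree\<close>

text \<open>Degree in the sense of Frechet. Unlike the degree of an expression, it is also defined for products of
a noncommutative polynomial with an arbitrary additive map.\<close>

primrec degree_less :: "nat \<Rightarrow> ('a::ring \<Rightarrow> 'a) \<Rightarrow> bool" where
  "degree_less 0 F \<longleftrightarrow> (\<forall>x. F x = 0)"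
| "degree_less (Suc d) F \<longleftrightarrow> (\<forall>y. degree_less d (\<lambda>x. F (x + y) - F x))"

lemma degree_less_zero: "degree_less d (\<lambda>x. 0)"
  by (induction d) auto

lemma degree_less_const: "degree_less (Suc d) (\<lambda>x. c)"
  by (simp add: degree_less_zero)

lemma degree_less_add:
  "degree_less d F \<Longrightarrow> degree_less d G \<Longrightarrow> degree_less d (\<lambda>x. F x + G x)"
proof (induction d arbitrary: F G)
  case (Suc d)
  have "degree_less d (\<lambda>x. (F (x + y) - F x) + (G (x + y) - G x))" for y
    using Suc by simp
  then show ?case by (simp add: algebra_simps)
qed auto

lemma degree_less_left_mult: "degree_less d F \<Longrightarrow> degree_less d (\<lambda>x. c * F x)"
proof (induction d arbitrary: F)
  case (Suc d)
  have "degree_less d (\<lambda>x. c * (F (x + y) - F x))" for y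
    using Suc by simp
  then show ?case by (simp add: right_diff_distrib)
qed auto

lemma degree_less_diff:
  fixes F G :: "'a::ring_1 \<Rightarrow> 'a"
  assumes "degree_less d F" "degree_less d G"
  shows "degree_less d (\<lambda>x. F x - G x)"
  using degree_less_add[OF assms(1) degree_less_left_mult[OF assms(2), of "-1"]] by simp

lemma degree_less_sum:
  assumes "finite I" "\<And>i. i \<in> I \<Longrightarrow> degree_less d (F i)"
  shows "degree_less d (\<lambda>x. \<Sum>i\<in>I. F i x)"
  using assms
proof (induction I rule: finite_induct)
  case empty then show ?case by (simp add: degree_less_zero)
next
  case (insert a I)
  have "degree_less d (\<lambda>x. F a x + (\<Sum>i\<in>I. F i x))"
    by (rule degree_less_add) (use insert in auto)
  with insert show ?case by simp
qed

lemma degree_less_shift: "degree_less d F \<Longrightarrow> degree_less d (\<lambda>x. F (x + a))"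
proof (induction d arbitrary: F)
  case (Suc d)
  have "degree_less d (\<lambda>x. F (x + a + y) - F (x + a))" for y
    using Suc.IH[of "\<lambda>x. F (x + y) - F x"] Suc.prems by simp
  then show ?case by (simp add: ac_simps)
qed auto

lemma degree_less_Suc: "degree_less d F \<Longrightarrow> degree_less (Suc d) F"
proof (induction d arbitrary: F)
  case (Suc d)
  show ?case
    by (subst degree_less.simps) (intro allI Suc.IH, use Suc.prems in simp)
qed auto

lemma degree_less_mono: "degree_less d F \<Longrightarrow> d \<le> e \<Longrightarrow> degree_less e F"
  by (induction e) (auto simp: le_Suc_eq simp del: degree_less.simps intro: degree_less_Suc)

lemma degree_less_id_mult: "degree_less d F \<Longrightarrow> degree_less (Suc d) (\<lambda>x. x * F x)"
proof (induction d arbitrary: F)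
  case 0 then show ?case by simp
next
  case (Suc d)
  have "degree_less (Suc d) (\<lambda>x. (x + y) * F (x + y) - x * F x)" for y
  proof -
    have "degree_less (Suc d) (\<lambda>x. x * (F (x + y) - F x) + y * F (x + y))"
      by (intro degree_less_add Suc.IH degree_less_left_mult degree_less_shift Suc.prems)
        (use Suc.prems in simp)
    then show ?thesis by (simp add: algebra_simps)
  qed
  then show ?case by (subst degree_less.simps) blast
qed

lemma degree_less_additive:
  assumes "additive f" shows "degree_less 2 f"
  using additive.add[OF assms] by (simp add: numeral_2_eq_2)

lemma degree_less_1_D:
  assumes "degree_less (Suc 0) F" shows "F x = F 0"
proof -
  have "F (0 + x) - F 0 = 0"
    using assms unfolding degree_less.simps by blast
  then show ?thesis by simp
qed

text \<open>The polynomial \<open>binom_tail n k\<close> is what remains of \<open>middle_terms n\<close> after its terms of degree less than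
\<open>k\<close> are dropped and \<open>x\<^sup>k\<close> is cancelled.\<close>

definition binom_tail :: "nat \<Rightarrow> nat \<Rightarrow> 'a::ring_1 \<Rightarrow> 'a" where
  "binom_tail n k x = (\<Sum>i\<in>{k..<n}. of_nat (n choose i) * x ^ (i - k))"

lemma binom_tail_step:
  fixes x :: "'a::ring_1"
  assumes "k < n"
  shows "binom_tail n k x = of_nat (n choose k) + x * binom_tail n (Suc k) x"
proof -
  have "x * (of_nat (n choose i) * x ^ (i - Suc k)) = of_nat (n choose i) * x ^ (i - k)"
    if "i \<in> {Suc k..<n}" for i
  proof -
    have "i - k = Suc (i - Suc k)" using that by auto
    then show ?thesis using mult_of_nat_commute[of "n choose i" x] by (simp flip: mult.assoc)
  qed
  then have "x * binom_tail n (Suc k) x = (\<Sum>i\<in>{Suc k..<n}. of_nat (n choose i) * x ^ (i - k))"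
    by (simp add: binom_tail_def sum_distrib_left)
  moreover have "{k..<n} = insert k {Suc k..<n}" using assms by auto
  ultimately show ?thesis by (simp add: binom_tail_def)
qed

lemma middle_terms_eq_tail: "n > 0 \<Longrightarrow> middle_terms n x = x * binom_tail n 1 x"
proof -
  assume "n > 0"
  have "x * (of_nat (n choose i) * x ^ (i - 1)) = of_nat (n choose i) * x ^ i"
    if "i \<in> {1..<n}" for i
  proof -
    have "i = Suc (i - 1)" using that by auto
    then show ?thesis using mult_of_nat_commute[of "n choose i" x]
      by (metis mult.assoc power_Suc)
  qed
  with \<open>n > 0\<close> show ?thesis
    by (simp add: middle_terms_eq_sum binom_tail_def sum_distrib_left)
qed

section \<open>Cancelling the variable in maps of bounded degree\<close>

text \<open>Take a vanishing combination \<open>\<Sum> a\<^sub>i x c\<^sub>i\<close> with as few nonzero \<open>c\<^sub>i\<close> as possible and scale one of them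
to 1. Its commutator with any \<open>y\<close> is a shorter combination, so the \<open>c\<^sub>i\<close> are central, and \<open>x = 1\<close> gives a
central dependence of the \<open>a\<^sub>i\<close>.\<close>

lemma central_independence:
  fixes a c :: "'i \<Rightarrow> 'a::division_ring"
  assumes fin: "finite I"
    and ind: "\<And>b. (\<And>i. i \<in> I \<Longrightarrow> central (b i)) \<Longrightarrow> (\<Sum>i\<in>I. a i * b i) = 0
                \<Longrightarrow> (\<And>i. i \<in> I \<Longrightarrow> b i = 0)"
    and zero: "\<And>x. (\<Sum>i\<in>I. a i * x * c i) = 0"
    and i: "i \<in> I"
  shows "c i = 0"
  using zero i
proof (induction "card {i \<in> I. c i \<noteq> 0}" arbitrary: c i rule: less_induct)
  case less
  show ?case
  proof (rule ccontr)
    assume nz: "c i \<noteq> 0"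
    define b where "b j = c j * inverse (c i)" for j
    have bi: "b i = 1" using nz by (simp add: b_def)
    have zb: "(\<Sum>j\<in>I. a j * x * b j) = 0" for x
    proof -
      have "(\<Sum>j\<in>I. a j * x * b j) = (\<Sum>j\<in>I. a j * x * c j) * inverse (c i)"
        by (simp add: b_def sum_distrib_right mult.assoc)
      with less.prems show ?thesis by simp
    qed
    have "y * b j - b j * y = 0" if "j \<in> I" for y j
    proof (rule less.hyps[where c = "\<lambda>j. y * b j - b j * y", OF _ _ that])
      have "{j \<in> I. y * b j - b j * y \<noteq> 0} \<subseteq> {j \<in> I. c j \<noteq> 0}"
        by (auto simp: b_def)
      moreover have "i \<in> {j \<in> I. c j \<noteq> 0}" "i \<notin> {j \<in> I. y * b j - b j * y \<noteq> 0}"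
        using nz less.prems bi by auto
      ultimately show "card {j \<in> I. y * b j - b j * y \<noteq> 0} < card {j \<in> I. c j \<noteq> 0}"
        using fin by (intro psubset_card_mono) auto
      show "(\<Sum>j\<in>I. a j * x * (y * b j - b j * y)) = 0" for x
      proof -
        have "(\<Sum>j\<in>I. a j * x * (y * b j - b j * y))
            = (\<Sum>j\<in>I. a j * (x * y) * b j) - (\<Sum>j\<in>I. a j * x * b j) * y"
          by (simp add: right_diff_distrib sum_subtractf sum_distrib_right mult.assoc)
        then show ?thesis by (simp add: zb)
      qed
    qed
    then have "central (b j)" if "j \<in> I" for j
      using that by (simp add: central_def)
    moreover have "(\<Sum>j\<in>I. a j * b j) = 0" using zb[of 1] by simp
    ultimately have "b i = 0" using ind less.prems(2) by blast
    with bi show False by simp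
  qed
qed

definition power_independent :: "'a::ring_1 \<Rightarrow> bool" where
  "power_independent t \<longleftrightarrow>
     (\<forall>s b. (\<forall>i\<le>s. central (b i)) \<longrightarrow> (\<Sum>i\<le>s. t ^ i * b i) = 0 \<longrightarrow> (\<forall>i\<le>s::nat. b i = 0))"

text \<open>Induction on the degree \<open>d\<close>. Let \<open>H x\<close> be the sum in the second premise. In
\<open>H (x + t y) - H x - t (H (x + y) - H x)\<close> the terms that have \<open>y\<close> in place of the leading \<open>x\<close> carry
second differences of the \<open>F i\<close>, which have smaller degree. What remains is a combination of the same
kind, with one more power of \<open>t\<close> and differences of the \<open>F i\<close> as coefficients, so the induction
hypothesis bounds the degrees of these differences. For constant \<open>F i\<close> the claim is the independence of
the powers of \<open>t\<close>.\<close>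

lemma degree_less_of_power_combination:
  fixes t :: "'a::division_ring"
  assumes t: "power_independent t"
  shows "(\<And>i. i \<le> s \<Longrightarrow> degree_less (Suc d) (F i))
    \<Longrightarrow> degree_less (Suc d) (\<lambda>x. \<Sum>i\<le>s. t ^ i * (x * F i x))
    \<Longrightarrow> i \<le> s \<Longrightarrow> degree_less d (F i)"
proof (induction d arbitrary: s F i)
  case 0
  have F: "F i x = F i 0" if "i \<le> s" for i x
    using degree_less_1_D[OF 0(1)[OF that]] .
  have zero: "(\<Sum>i\<le>s. t ^ i * x * F i 0) = 0" for x
  proof -
    have "(\<Sum>i\<le>s. t ^ i * x * F i 0) = (\<Sum>i\<le>s. t ^ i * (x * F i x))"
      by (intro sum.cong refl) (metis F atMost_iff mult.assoc)
    also have "\<dots> = 0" using degree_less_1_D[OF 0(2), of x] by simp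
    finally show ?thesis .
  qed
  have "F i 0 = 0" if "i \<le> s" for i
  proof (rule central_independence[of "{..s}" "\<lambda>i. t ^ i" "\<lambda>i. F i 0"])
    fix b i assume "\<And>i. i \<in> {..s} \<Longrightarrow> central (b i)" "(\<Sum>i\<le>s. t ^ i * b i) = 0" "i \<in> {..s}"
    then show "b i = 0" using t unfolding power_independent_def by blast
  qed (use that zero in auto)
  with F 0(3) show ?case by (metis degree_less.simps(1))
next
  case (Suc d)
  define H where "H x = (\<Sum>i\<le>s. t ^ i * (x * F i x))" for x
  have dF: "degree_less (Suc d) (\<lambda>x. F i (x + y) - F i x)" if "i \<le> s" for i y
    using Suc.prems(1)[OF that] by (subst (asm) degree_less.simps) blast
  have dH: "degree_less (Suc d) (\<lambda>x. H (x + y) - H x)" for y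
    using Suc.prems(2) unfolding H_def by (subst (asm) degree_less.simps) blast
  \<comment> \<open>Downward induction on \<open>i\<close>: the coefficient of the power \<open>Suc i\<close> below involves the difference of \<open>F i\<close>
    in direction \<open>y\<close> and that of \<open>F (Suc i)\<close> in direction \<open>t * y\<close>.\<close>
  have "degree_less d (\<lambda>x. F i (x + y) - F i x)" if "i \<le> s" for i y
    using that
  proof (induction "s - i" arbitrary: i y rule: less_induct)
    case less
    define G where "G j x = (if j \<le> s then F j (x + t * y) - F j x else 0)
       - (case j of 0 \<Rightarrow> 0 | Suc k \<Rightarrow> F k (x + y) - F k x)" for j x
    have dG: "degree_less (Suc d) (G j)" if "j \<le> Suc s" for j
    proof -
      have "degree_less (Suc d) (\<lambda>x. if j \<le> s then F j (x + t * y) - F j x else 0)"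
        by (cases "j \<le> s") (simp_all del: degree_less.simps add: dF degree_less_zero)
      moreover have "degree_less (Suc d) (\<lambda>x. case j of 0 \<Rightarrow> 0 | Suc k \<Rightarrow> F k (x + y) - F k x)"
        using that by (cases j) (simp_all del: degree_less.simps add: dF degree_less_zero)
      ultimately show ?thesis unfolding G_def by (rule degree_less_diff)
    qed
    have eq: "(\<Sum>j\<le>Suc s. t ^ j * (x * G j x)) = (H (x + t * y) - H x) - t * (H (x + y) - H x)
        - (\<Sum>i\<le>s. t ^ Suc i * y * ((F i (x + t * y) - F i x) - (F i (x + y) - F i x)))" for x
    proof -
      have comm: "t ^ j * (t * u) = t * (t ^ j * u)" for j u
        by (simp add: power_commutes flip: mult.assoc)
      have "(\<Sum>j\<le>Suc s. t ^ j * (x * G j x))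
          = (\<Sum>j\<le>s. t ^ j * (x * (F j (x + t * y) - F j x)))
          - (\<Sum>j\<le>Suc s. t ^ j * (x * (case j of 0 \<Rightarrow> 0 | Suc k \<Rightarrow> F k (x + y) - F k x)))"
        by (simp add: G_def right_diff_distrib sum_subtractf)
      also have "\<dots> = (\<Sum>j\<le>s. t ^ j * (x * (F j (x + t * y) - F j x)))
          - (\<Sum>j\<le>s. t ^ Suc j * (x * (F j (x + y) - F j x)))"
        by (subst sum.atMost_Suc_shift) simp
      also have "\<dots> = (H (x + t * y) - H x) - t * (H (x + y) - H x)
        - (\<Sum>i\<le>s. t ^ Suc i * y * ((F i (x + t * y) - F i x) - (F i (x + y) - F i x)))"
        unfolding H_def
        by (simp add: sum_distrib_left flip: sum_subtractf)
          (rule sum.cong, simp_all add: comm algebra_simps)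
      finally show ?thesis .
    qed
    have "degree_less (Suc d) (\<lambda>x. \<Sum>j\<le>Suc s. t ^ j * (x * G j x))"
      unfolding eq
      by (intro degree_less_diff degree_less_left_mult degree_less_sum dH dF) auto
    then have "degree_less d (G (Suc i))"
      using Suc.IH[of "Suc s" G "Suc i"] dG less.prems by (simp del: degree_less.simps)
    moreover have "degree_less d (\<lambda>x. if Suc i \<le> s then F (Suc i) (x + t * y) - F (Suc i) x else 0)"
      using less.hyps[of "Suc i" "t * y"] less.prems
      by (cases "Suc i \<le> s") (auto simp: degree_less_zero)
    ultimately have "degree_less d (\<lambda>x. (if Suc i \<le> s then F (Suc i) (x + t * y) - F (Suc i) x else 0)
        - G (Suc i) x)"
      by (rule degree_less_diff[rotated])
    then show ?case by (simp add: G_def)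
  qed
  then show ?case using Suc.prems(3) by simp
qed

text \<open>The degree of \<open>F\<close> drops by one as long as it exceeds the bound, by the previous lemma with the single
power \<open>t\<^sup>0\<close>; further powers of \<open>t\<close> occur only inside the induction proving that lemma.\<close>

lemma degree_less_cancel_id_mult:
  fixes t :: "'a::division_ring" and F :: "'a \<Rightarrow> 'a"
  assumes t: "power_independent t"
    and "degree_less m F" and "degree_less (Suc e) (\<lambda>x. x * F x)"
  shows "degree_less e F"
  using assms(2)
proof (induction m)
  case 0 then show ?case by (rule degree_less_mono) simp
next
  case (Suc m)
  show ?case
  proof (cases "Suc m \<le> e")
    case True then show ?thesis using Suc.prems degree_less_mono by blast
  next
    case False
    then have "degree_less (Suc m) (\<lambda>x. x * F x)"
      using assms(3) by (auto intro: degree_less_mono simp del: degree_less.simps)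
    then have "degree_less m F"
      using degree_less_of_power_combination[OF t, of 0 m "\<lambda>_. F" 0] Suc.prems by simp
    then show ?thesis by (rule Suc.IH)
  qed
qed

lemma degree_less_power_mult:
  fixes F :: "'a::ring_1 \<Rightarrow> 'a"
  shows "degree_less d F \<Longrightarrow> degree_less (d + j) (\<lambda>x. x ^ j * F x)"
proof (induction j)
  case (Suc j)
  then show ?case
    using degree_less_id_mult[of "d + j" "\<lambda>x. x ^ j * F x"] by (simp add: mult.assoc del: degree_less.simps)
qed simp

lemma degree_less_binom_tail_mult:
  fixes h :: "'a::ring_1 \<Rightarrow> 'a"
  assumes "degree_less d h"
  shows "degree_less (d + n) (\<lambda>x. binom_tail n k x * h x)"
proof -
  have "degree_less (d + n) (\<lambda>x. \<Sum>i\<in>{k..<n}. of_nat (n choose i) * (x ^ (i - k) * h x))"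
    by (intro degree_less_sum degree_less_left_mult degree_less_mono[OF degree_less_power_mult[OF assms]]) auto
  then show ?thesis by (simp add: binom_tail_def sum_distrib_right mult.assoc)
qed

text \<open>If \<open>c h x + x G x = 0\<close>, where \<open>c\<close> is the lowest coefficient of the tail and \<open>G x\<close> is the next tail times
\<open>h x\<close>, then \<open>x G x\<close> has the small degree of \<open>h\<close>. Cancelling \<open>x\<close> leaves \<open>G\<close> constant in the additive case
and zero in the constant case; in the additive case the constant is \<open>G 0 = 0\<close>. The two cases serve the
two uses of the lemma: a solution \<open>f\<close>, and the map \<open>1\<close> when \<open>T\<close> itself is studied.\<close>

lemma binom_tail_mult_eq_0_step:
  fixes t :: "'a::division_ring" and h :: "'a \<Rightarrow> 'a"
  assumes t: "power_independent t"
    and h: "(additive h) \<or> (\<forall>x. h x = h 0)"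
    and "k < n" and zero: "\<And>x. binom_tail n k x * h x = 0"
  shows "of_nat (n choose k) * h x = 0" "binom_tail n (Suc k) x * h x = 0"
proof -
  let ?F = "\<lambda>x. binom_tail n (Suc k) x * h x"
  have eq: "x * ?F x = - 1 * (of_nat (n choose k) * h x)" for x
    using zero[of x] binom_tail_step[OF \<open>k < n\<close>, of x]
    by (simp add: distrib_right mult.assoc eq_neg_iff_add_eq_0 add.commute)
  have h2: "degree_less 2 h"
    using h degree_less_additive degree_less_mono[OF degree_less_const[of 0 "h 0"], of 2]
    by (metis ext one_le_numeral One_nat_def)
  note F = degree_less_binom_tail_mult[OF h2, of n "Suc k"]
  have F0: "?F x = 0" for x
    using h
  proof
    assume "additive h"
    have "degree_less 2 (\<lambda>x. x * ?F x)"
      unfolding eq by (intro degree_less_left_mult h2)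
    then have "degree_less (Suc 0) ?F"
      using degree_less_cancel_id_mult[OF t F, of 1] by (simp only: numeral_2_eq_2 One_nat_def)
    then have "?F x = ?F 0" by (rule degree_less_1_D)
    with \<open>additive h\<close> show ?thesis by (simp add: additive.zero)
  next
    assume "\<forall>x. h x = h 0"
    then have "x * ?F x = - 1 * (of_nat (n choose k) * h 0)" for x using eq by metis
    then have "degree_less (Suc 0) (\<lambda>x. x * ?F x)"
      using degree_less_const[of 0 "- 1 * (of_nat (n choose k) * h 0)"] by (simp only:)
    then have "degree_less 0 ?F"
      by (rule degree_less_cancel_id_mult[OF t F])
    then show ?thesis by simp
  qed
  then show "?F x = 0" .
  show "of_nat (n choose k) * h x = 0" using eq[of x] F0[of x] by simp
qed

lemma binom_tail_mult_eq_0: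
  fixes t :: "'a::division_ring" and h :: "'a \<Rightarrow> 'a"
  assumes t: "power_independent t"
    and h: "(additive h) \<or> (\<forall>x. h x = h 0)"
    and zero: "\<And>x. binom_tail n k x * h x = 0"
    and "k \<le> j" "j < n"
  shows "of_nat (n choose j) * h x = 0"
proof -
  have "binom_tail n j x * h x = 0" for x
    using \<open>k \<le> j\<close> \<open>j < n\<close>
  proof (induction j arbitrary: x rule: dec_induct)
    case base then show ?case using zero by simp
  next
    case (step i) then show ?case
      using binom_tail_mult_eq_0_step(2)[OF t h, of i n x] by simp
  qed
  then show ?thesis using binom_tail_mult_eq_0_step(1)[OF t h \<open>j < n\<close>] by blast
qed

text \<open>An additive \<open>T x = x R x\<close> would make \<open>R\<close> constant, so all coefficients of \<open>R\<close> beyond the first would vanish.\<close>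

lemma middle_terms_not_additive_of_power_independent:
  fixes t :: "'a::division_ring"
  assumes t: "power_independent t"
    and k: "2 \<le> k" "k < n" "(of_nat (n choose k) :: 'a) \<noteq> 0"
  shows "\<not> additive (middle_terms n :: 'a \<Rightarrow> 'a)"
proof
  assume add: "additive (middle_terms n :: 'a \<Rightarrow> 'a)"
  have tail: "degree_less (Suc 0 + n) (binom_tail n i :: 'a \<Rightarrow> 'a)" for i
    using degree_less_binom_tail_mult[OF degree_less_const[of 0 1], of n i] by (simp del: degree_less.simps)
  have "middle_terms n = (\<lambda>x::'a. x * binom_tail n 1 x)"
    using k middle_terms_eq_tail[of n] by (intro ext) auto
  then have "degree_less 2 (\<lambda>x::'a. x * binom_tail n 1 x)"
    using degree_less_additive[OF add] by (simp only:)
  then have "degree_less 1 (binom_tail n 1 :: 'a \<Rightarrow> 'a)"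
    using degree_less_cancel_id_mult[OF t tail, of 1] by (simp only: numeral_2_eq_2 One_nat_def)
  then have "degree_less 1 (\<lambda>x::'a. binom_tail n 1 x - of_nat (n choose 1))"
    by (intro degree_less_diff) (simp_all add: degree_less_zero)
  moreover have "binom_tail n 1 x - of_nat (n choose 1) = x * binom_tail n 2 x" for x :: 'a
    using binom_tail_step[of 1 n x] k by (simp add: numeral_2_eq_2)
  ultimately have "degree_less (Suc 0) (\<lambda>x::'a. x * binom_tail n 2 x)"
    by (simp only: One_nat_def)
  then have "degree_less 0 (binom_tail n 2 :: 'a \<Rightarrow> 'a)"
    by (rule degree_less_cancel_id_mult[OF t tail])
  then have "(of_nat (n choose k) :: 'a) * 1 = 0"
    using binom_tail_mult_eq_0[OF t, of "\<lambda>_. 1" n 2 k] k by simp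
  with k show False by simp
qed

text \<open>The map \<open>x \<mapsto> f (x x)\<close> is quadratic, so \<open>x\<close> can be cancelled twice from \<open>T x (f x)\<close>, which leaves
constants. Since \<open>f 0 = 0\<close>, the tails times \<open>f\<close> vanish from degree two onwards.\<close>

lemma additive_square_eq_0_of_power_independent:
  fixes t :: "'a::division_ring" and f :: "'a \<Rightarrow> 'a"
  assumes t: "power_independent t"
    and k: "2 \<le> k" "k < n" "(of_nat (n choose k) :: 'a) \<noteq> 0"
    and f: "additive f" and sq: "\<And>x. f (x * x) = middle_terms n x * f x"
  shows "f x = 0"
proof -
  note add = additive.add[OF f]
  note f2 = degree_less_additive[OF f]
  note tail = degree_less_binom_tail_mult[OF f2, of n]
  have "degree_less 2 (\<lambda>x. f ((x + y) * (x + y)) - f (x * x))" for y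
  proof -
    have "degree_less 2 (\<lambda>x. f (x * y + y * x) + f (y * y))"
      by (intro degree_less_add degree_less_additive degree_less_mono[OF degree_less_const])
        (auto simp: additive_def algebra_simps add)
    then show ?thesis by (simp add: algebra_simps add)
  qed
  then have "degree_less 3 (\<lambda>x. f (x * x))"
    by (simp only: eval_nat_numeral degree_less.simps) simp
  then have "degree_less 3 (\<lambda>x. x * (binom_tail n 1 x * f x))"
    using sq k by (simp add: middle_terms_eq_tail mult.assoc)
  then have "degree_less 2 (\<lambda>x. binom_tail n 1 x * f x)"
    using degree_less_cancel_id_mult[OF t tail, of 2] by (simp only: eval_nat_numeral)
  then have "degree_less 2 (\<lambda>x. binom_tail n 1 x * f x - of_nat (n choose 1) * f x)"
    by (intro degree_less_diff degree_less_left_mult f2)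
  moreover have "binom_tail n 1 x * f x - of_nat (n choose 1) * f x = x * (binom_tail n 2 x * f x)" for x
    using binom_tail_step[of 1 n x] k by (simp add: numeral_2_eq_2 distrib_right mult.assoc)
  ultimately have "degree_less 2 (\<lambda>x. x * (binom_tail n 2 x * f x))"
    by (simp only:)
  then have "degree_less (Suc 0) (\<lambda>x. binom_tail n 2 x * f x)"
    using degree_less_cancel_id_mult[OF t tail, of 1] by (simp only: numeral_2_eq_2 One_nat_def)
  then have "binom_tail n 2 x * f x = 0" for x
    using degree_less_1_D[of "\<lambda>x. binom_tail n 2 x * f x" x] additive.zero[OF f] by simp
  then have "of_nat (n choose k) * f x = 0"
    using binom_tail_mult_eq_0[OF t, of f n 2 k] f k by blast
  with k show ?thesis by simp
qed

section \<open>Polynomial functions of a central variable\<close>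

text \<open>Division of a polynomial in a central variable by \<open>z - z\<^sub>0\<close>. The leading coefficient is recorded
because the Vandermonde argument recurses on it.\<close>

lemma sum_power_quotient:
  fixes c :: "nat \<Rightarrow> 'a::ring_1"
  assumes "central z0"
  shows "\<exists>q. q N = c (Suc N) \<and> (\<forall>z. central z \<longrightarrow>
    (\<Sum>k\<le>Suc N. z ^ k * c k) - (\<Sum>k\<le>Suc N. z0 ^ k * c k) = (z - z0) * (\<Sum>k\<le>N. z ^ k * q k))"
proof (induction N arbitrary: c)
  case 0
  show ?case by (intro exI[of _ "\<lambda>_. c (Suc 0)"]) (simp add: algebra_simps)
next
  case (Suc N)
  let ?p = "\<lambda>z. \<Sum>k\<le>Suc N. z ^ k * c (Suc k)"
  obtain q where q: "q N = c (Suc (Suc N))"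
      "\<And>z. central z \<Longrightarrow> ?p z - ?p z0 = (z - z0) * (\<Sum>k\<le>N. z ^ k * q k)"
    using Suc[of "\<lambda>k. c (Suc k)"] by blast
  define r where "r k = c (Suc k) + z0 * (if k \<le> N then q k else 0)" for k
  have p: "(\<Sum>k\<le>Suc (Suc N). z ^ k * c k) = c 0 + z * ?p z" for z
    by (subst sum.atMost_Suc_shift) (simp add: sum_distrib_left distrib_left mult.assoc)
  have "(\<Sum>k\<le>Suc (Suc N). z ^ k * c k) - (\<Sum>k\<le>Suc (Suc N). z0 ^ k * c k)
      = (z - z0) * (\<Sum>k\<le>Suc N. z ^ k * r k)" if "central z" for z
  proof -
    have "z ^ k * (z0 * x) = z0 * (z ^ k * x)" for k x
      using central_left_commute[OF assms] .
    then have "(\<Sum>k\<le>Suc N. z ^ k * r k) = ?p z + z0 * (\<Sum>k\<le>N. z ^ k * q k)"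
      by (simp add: r_def distrib_left sum.distrib sum_distrib_left)
    then have "(z - z0) * (\<Sum>k\<le>Suc N. z ^ k * r k)
        = (z - z0) * ?p z + z0 * ((z - z0) * (\<Sum>k\<le>N. z ^ k * q k))"
      by (simp only: distrib_left central_left_commute[OF assms])
    also have "\<dots> = (z - z0) * ?p z + z0 * (?p z - ?p z0)"
      by (simp only: q(2)[OF that])
    finally show ?thesis unfolding p by (simp add: algebra_simps)
  qed
  then show ?case by (intro exI[of _ r]) (simp add: r_def)
qed

lemma central_vandermonde:
  fixes c :: "nat \<Rightarrow> 'a::division_ring"
  assumes "infinite A" "\<And>z. z \<in> A \<Longrightarrow> central z"
    and "\<And>z. z \<in> A \<Longrightarrow> (\<Sum>k\<le>N. z ^ k * c k) = 0" and "k \<le> N"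
  shows "c k = 0"
  using assms
proof (induction N arbitrary: A c k)
  case 0
  then obtain z where "z \<in> A" by (metis finite.emptyI all_not_in_conv)
  with 0 show ?case by fastforce
next
  case (Suc N)
  then obtain z0 where z0: "z0 \<in> A" by (metis finite.emptyI all_not_in_conv)
  obtain q where q: "q N = c (Suc N)"
      "\<And>z. central z \<Longrightarrow> (\<Sum>k\<le>Suc N. z ^ k * c k) - (\<Sum>k\<le>Suc N. z0 ^ k * c k)
         = (z - z0) * (\<Sum>k\<le>N. z ^ k * q k)"
    using sum_power_quotient[OF Suc.prems(2)[OF z0], of N c] by blast
  have "(\<Sum>k\<le>N. z ^ k * q k) = 0" if "z \<in> A - {z0}" for z
    using q(2)[of z] Suc.prems(2,3) that z0 by auto
  then have "q N = 0"
    using Suc.IH[of "A - {z0}" q N] Suc.prems(1,2) by simp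
  then have last: "c (Suc N) = 0" using q(1) by simp
  then have "(\<Sum>k\<le>N. z ^ k * c k) = 0" if "z \<in> A" for z
    using Suc.prems(3)[OF that] by simp
  then have "c k = 0" if "k \<le> N" for k
    using Suc.IH[of A c k] Suc.prems(1,2) that by simp
  with last show ?case using Suc.prems(4) by (auto simp: le_Suc_eq)
qed

text \<open>Only the values at central arguments matter, because only for them does collecting the coefficients on
one side respect products.\<close>

definition central_poly :: "('a::ring_1 \<Rightarrow> 'a) \<Rightarrow> bool" where
  "central_poly G \<longleftrightarrow> (\<exists>N c. \<forall>z. central z \<longrightarrow> G z = (\<Sum>k\<le>N::nat. z ^ k * c k))"

lemma central_polyI:
  "(\<And>z. central z \<Longrightarrow> G z = (\<Sum>k\<le>N. z ^ k * c k)) \<Longrightarrow> central_poly G"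
  unfolding central_poly_def by blast

lemma central_poly_const: "central_poly (\<lambda>z. a)"
  unfolding central_poly_def by (intro exI[of _ 0] exI[of _ "\<lambda>_. a"]) simp

lemma central_poly_add:
  assumes "central_poly G" "central_poly H" shows "central_poly (\<lambda>z. G z + H z)"
proof -
  obtain N c M d where G: "\<And>z. central z \<Longrightarrow> G z = (\<Sum>k\<le>N. z ^ k * c k)"
    and H: "\<And>z. central z \<Longrightarrow> H z = (\<Sum>k\<le>M. z ^ k * d k)"
    using assms unfolding central_poly_def by metis
  have ext: "(\<Sum>k\<le>L. z ^ k * e k) = (\<Sum>k\<le>max N M. z ^ k * (if k \<le> L then e k else 0))"
    if "L \<le> max N M" for L e and z :: 'a
    using that by (intro sum.mono_neutral_cong_left) auto
  have "G z + H z = (\<Sum>k\<le>max N M. z ^ k * ((if k \<le> N then c k else 0) + (if k \<le> M then d k else 0)))"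
    if "central z" for z
    by (simp only: G[OF that] H[OF that] distrib_left sum.distrib ext[where L = N] ext[where L = M] max.cobounded1 max.cobounded2)
  then show ?thesis by (rule central_polyI)
qed

lemma central_poly_id_mult:
  assumes "central_poly G" shows "central_poly (\<lambda>z. z * G z)"
proof -
  obtain N c where G: "\<And>z. central z \<Longrightarrow> G z = (\<Sum>k\<le>N. z ^ k * c k)"
    using assms unfolding central_poly_def by metis
  have "z * G z = (\<Sum>k\<le>Suc N. z ^ k * (case k of 0 \<Rightarrow> 0 | Suc j \<Rightarrow> c j))" if "central z" for z
    using G[OF that] by (subst sum.atMost_Suc_shift) (simp add: sum_distrib_left mult.assoc)
  then show ?thesis by (rule central_polyI)
qed

lemma central_poly_left_mult:
  assumes "central_poly G" shows "central_poly (\<lambda>z. a * G z)"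
proof -
  obtain N c where G: "\<And>z. central z \<Longrightarrow> G z = (\<Sum>k\<le>N. z ^ k * c k)"
    using assms unfolding central_poly_def by metis
  have "a * G z = (\<Sum>k\<le>N. z ^ k * (a * c k))" if "central z" for z
    using G[OF that] central_left_commute[OF central_power[OF that]] by (simp add: sum_distrib_left)
  then show ?thesis by (rule central_polyI)
qed

lemma central_poly_diff:
  assumes "central_poly G" "central_poly H" shows "central_poly (\<lambda>z. G z - H z)"
  using central_poly_add[OF assms(1) central_poly_left_mult[OF assms(2), of "- 1"]] by simp

lemma central_poly_sum:
  assumes "finite I" "\<And>i. i \<in> I \<Longrightarrow> central_poly (G i)" shows "central_poly (\<lambda>z. \<Sum>i\<in>I. G i z)"
  using assms by (induction I) (simp_all add: central_poly_const central_poly_add)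

lemma central_poly_power_mult:
  "central_poly G \<Longrightarrow> central_poly (\<lambda>z. z ^ m * G z)"
  by (induction m) (simp_all add: mult.assoc central_poly_id_mult)

lemma central_poly_cong:
  "central_poly G \<Longrightarrow> (\<And>z. central z \<Longrightarrow> H z = G z) \<Longrightarrow> central_poly H"
  by (simp add: central_poly_def)

lemma central_poly_mult:
  assumes "central_poly G" "central_poly H" shows "central_poly (\<lambda>z. G z * H z)"
proof -
  obtain N c where G: "\<And>z. central z \<Longrightarrow> G z = (\<Sum>k\<le>N. z ^ k * c k)"
    using assms unfolding central_poly_def by metis
  have "central_poly (\<lambda>z. \<Sum>k\<le>N. z ^ k * (c k * H z))"
    by (intro central_poly_sum central_poly_power_mult central_poly_left_mult assms) simp
  then show ?thesis
    by (rule central_poly_cong) (simp add: G sum_distrib_right mult.assoc)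
qed

lemma central_poly_id: "central_poly (\<lambda>z. z)"
  using central_poly_id_mult[OF central_poly_const[of 1]] by simp

lemma central_poly_power: "central_poly G \<Longrightarrow> central_poly (\<lambda>z. G z ^ m)"
  by (induction m) (simp_all add: central_poly_const central_poly_mult)

lemmas central_poly_intros = central_poly_const central_poly_add central_poly_diff
  central_poly_mult central_poly_power central_poly_id

lemma central_poly_eq_0:
  fixes G :: "'a::division_ring \<Rightarrow> 'a"
  assumes "central_poly G" "infinite A" "\<And>z. z \<in> A \<Longrightarrow> central z" "\<And>z. z \<in> A \<Longrightarrow> G z = 0"
    and "central z"
  shows "G z = 0"
proof -
  obtain N c where G: "\<And>z. central z \<Longrightarrow> G z = (\<Sum>k\<le>N. z ^ k * c k)"
    using assms unfolding central_poly_def by metis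
  then have "c k = 0" if "k \<le> N" for k
    using central_vandermonde[of A c N k] assms that by simp
  then show ?thesis using G[OF \<open>central z\<close>] by simp
qed

lemma central_poly_constant_term_eq_0:
  fixes R :: "'a::division_ring \<Rightarrow> 'a"
  assumes inf: "infinite {z::'a. central z}" and R: "central_poly R"
    and zero: "\<And>z. central z \<Longrightarrow> a + z * R z = 0"
  shows "a = 0" "central z \<Longrightarrow> R z = 0"
proof -
  show "a = 0" using zero[of 0] by simp
  then have "R z = 0" if "z \<in> {z. central z} - {0}" for z
    using zero[of z] that by simp
  note R_nz = this
  show "R z = 0" if "central z"
    by (rule central_poly_eq_0[OF R _ _ _ that, of "{z. central z} - {0}"]) (use inf R_nz in auto)
qed

text \<open>Splits off the first two coefficients, which is all that comparing coefficients of \<open>z\<close> requires.\<close>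

lemma central_poly_decomp:
  fixes G :: "'a::ring_1 \<Rightarrow> 'a"
  assumes "central_poly G"
  obtains b R where "central_poly R" "\<And>z. central z \<Longrightarrow> G z = G 0 + z * (b + z * R z)"
proof -
  have one: "\<exists>R. central_poly R \<and> (\<forall>z. central z \<longrightarrow> H z = H 0 + z * R z)"
    if H: "central_poly H" for H :: "'a \<Rightarrow> 'a"
  proof -
    obtain N c where c: "\<And>z. central z \<Longrightarrow> H z = (\<Sum>k\<le>N. z ^ k * c k)"
      using H unfolding central_poly_def by metis
    define d where "d k = (if k \<le> N then c k else 0)" for k
    have Hd: "H z = (\<Sum>k\<le>Suc N. z ^ k * d k)" if "central z" for z
      using c[OF that] by (simp add: d_def)
    have H': "H z = d 0 + z * (\<Sum>k\<le>N. z ^ k * d (Suc k))" if "central z" for z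
      unfolding Hd[OF that] by (subst sum.atMost_Suc_shift) (simp add: sum_distrib_left mult.assoc)
    have "H 0 = d 0" using H'[of 0] by simp
    with H' show ?thesis
      by (intro exI[of _ "\<lambda>z. \<Sum>k\<le>N. z ^ k * d (Suc k)"])
        (auto intro!: central_poly_sum central_poly_intros)
  qed
  obtain R where R: "central_poly R" "\<And>z. central z \<Longrightarrow> G z = G 0 + z * R z"
    using one[OF assms] by blast
  obtain R' where R': "central_poly R'" "\<And>z. central z \<Longrightarrow> R z = R 0 + z * R' z"
    using one[OF R(1)] by blast
  show thesis by (rule that[OF R'(1), of "R 0"]) (metis R(2) R'(2))
qed

section \<open>Infinite centre\<close>

definition ad :: "'a::ring \<Rightarrow> 'a \<Rightarrow> 'a" where
  "ad u v = u * v - v * u"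

lemma ad_funpow:
  fixes u v :: "'a::ring_1"
  shows "(ad u ^^ m) v = (\<Sum>j\<le>m. of_int ((- 1) ^ j * int (m choose j)) * (u ^ (m - j) * v * u ^ j))"
proof (induction m)
  case 0 then show ?case by simp
next
  case (Suc m)
  let ?c = "\<lambda>m j. of_int ((- 1) ^ j * int (m choose j)) :: 'a"
  have L: "u * (?c m j * (u ^ (m - j) * v * u ^ j)) = ?c m j * (u ^ (Suc m - j) * v * u ^ j)"
    if "j \<le> m" for j
    using mult_of_int_commute[of "(- 1) ^ j * int (m choose j)" u] that
    by (simp add: Suc_diff_le flip: mult.assoc)
  have R: "(?c m j * (u ^ (m - j) * v * u ^ j)) * u = ?c m j * (u ^ (m - j) * v * u ^ Suc j)" for j
    by (simp only: mult.assoc power_Suc2)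
  have coef: "?c m (Suc j) - ?c m j = ?c (Suc m) (Suc j)" for j
    by (simp only: of_int_diff[symmetric]) (simp add: algebra_simps)
  have "(ad u ^^ Suc m) v = (\<Sum>j\<le>m. u * (?c m j * (u ^ (m - j) * v * u ^ j)))
      - (\<Sum>j\<le>m. (?c m j * (u ^ (m - j) * v * u ^ j)) * u)"
    by (simp only: funpow.simps o_apply Suc.IH ad_def sum_distrib_left sum_distrib_right)
  also have "(\<Sum>j\<le>m. u * (?c m j * (u ^ (m - j) * v * u ^ j)))
      = (\<Sum>j\<le>Suc m. ?c m j * (u ^ (Suc m - j) * v * u ^ j))"
    using L by (simp add: binomial_eq_0 del: of_int_mult)
  also have "\<dots> = u ^ Suc m * v + (\<Sum>j\<le>m. ?c m (Suc j) * (u ^ (m - j) * v * u ^ Suc j))"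
    by (subst sum.atMost_Suc_shift) simp
  also have "\<dots> - (\<Sum>j\<le>m. (?c m j * (u ^ (m - j) * v * u ^ j)) * u)
      = u ^ Suc m * v + (\<Sum>j\<le>m. ?c (Suc m) (Suc j) * (u ^ (m - j) * v * u ^ Suc j))"
    by (simp only: R add_diff_eq[symmetric] sum_subtractf[symmetric] left_diff_distrib[symmetric] coef)
  also have "\<dots> = (\<Sum>j\<le>Suc m. ?c (Suc m) j * (u ^ (Suc m - j) * v * u ^ j))"
    by (subst sum.atMost_Suc_shift) simp
  finally show ?case .
qed

text \<open>Take \<open>k\<close> minimal. As \<open>(u + z)\<^sup>k\<close> is central for central \<open>z\<close>, comparing coefficients makes
\<open>(k choose i) u\<^sup>i\<close> central, so by minimality the middle coefficients vanish in the ring. Therefore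
\<open>(Y + 1)\<^sup>k = Y\<^sup>k + 1\<close> for all \<open>Y\<close>, and the \<open>k\<close>-th power of \<open>ad u\<close> is \<open>ad (u\<^sup>k) = 0\<close>. A nilpotent nonzero
\<open>ad u\<close> yields \<open>w\<close> with \<open>u w - w u = u\<close>, that is, \<open>u\<close> conjugates \<open>w\<close> to \<open>w + 1\<close>. The set \<open>S\<close> contains \<open>w\<close>
or \<open>w + u\<close>, so the \<open>k\<close>-th power of one of them is central and equal to itself plus 1.\<close>

lemma no_central_powers:
  fixes S :: "'a::division_ring set"
  assumes inf: "infinite {z::'a. central z}"
    and ne: "S \<noteq> {}" and noncentral: "\<And>u. u \<in> S \<Longrightarrow> \<not> central u"
    and shift: "\<And>u z. u \<in> S \<Longrightarrow> central z \<Longrightarrow> u + z \<in> S"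
    and big: "\<And>u y. u \<in> S \<Longrightarrow> y \<in> S \<or> y + u \<in> S"
    and k0: "k0 > 0" "\<And>u. u \<in> S \<Longrightarrow> central (u ^ k0)"
  shows False
proof -
  define k where "k = (LEAST k. k > 0 \<and> (\<forall>u\<in>S. central (u ^ k)))"
  have k: "k > 0" "\<And>u. u \<in> S \<Longrightarrow> central (u ^ k)"
    using LeastI[of "\<lambda>k. k > 0 \<and> (\<forall>u\<in>S. central (u ^ k))" k0] k0 unfolding k_def by auto
  have minimal: "\<not> (\<forall>u\<in>S. central (u ^ i))" if "0 < i" "i < k" for i
    using not_less_Least[of i "\<lambda>k. k > 0 \<and> (\<forall>u\<in>S. central (u ^ k))"] that unfolding k_def by blast
  have binom0: "(of_nat (k choose i) :: 'a) = 0" if i: "0 < i" "i < k" for i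
  proof (rule ccontr)
    assume nz: "(of_nat (k choose i) :: 'a) \<noteq> 0"
    have "u ^ i * y = y * u ^ i" if "u \<in> S" for u y
    proof -
      let ?c = "\<lambda>j. of_nat (k choose j) * (u ^ (k - j) * y - y * u ^ (k - j))"
      have "(\<Sum>j\<le>k. z ^ j * ?c j) = 0" if z: "central z" for z
      proof -
        have "(\<Sum>j\<le>k. z ^ j * ?c j) = (\<Sum>j\<le>k. of_nat (k choose j) * z ^ j * u ^ (k - j)) * y
            - y * (\<Sum>j\<le>k. of_nat (k choose j) * z ^ j * u ^ (k - j))"
          unfolding sum_distrib_left sum_distrib_right sum_subtractf[symmetric]
        proof (intro sum.cong refl)
          fix j
          let ?a = "of_nat (k choose j) * z ^ j" and ?x = "u ^ (k - j)"
          have "central ?a"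
            using z by (simp add: central_mult central_power)
          then have "y * (?a * ?x) = ?a * (y * ?x)" by (rule central_left_commute)
          moreover have "z ^ j * ?c j = ?a * (?x * y - y * ?x)"
            by (simp only: mult.assoc central_left_commute[OF central_power[OF z], symmetric])
          ultimately show "z ^ j * ?c j = ?a * ?x * y - y * (?a * ?x)"
            by (simp only: right_diff_distrib mult.assoc)
        qed
        also have "(\<Sum>j\<le>k. of_nat (k choose j) * z ^ j * u ^ (k - j)) = (u + z) ^ k"
          using binomial_commuting[of z u k] centralD[OF z, of u] by (simp add: add.commute)
        finally show ?thesis
          using centralD[OF k(2)[OF shift[OF \<open>u \<in> S\<close> z]], of y] by simp
      qed
      then have "?c (k - i) = 0"
        using central_vandermonde[OF inf, of ?c k "k - i"] by simp
      with nz i binomial_symmetric[of i k] show ?thesis by simp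
    qed
    then have "\<forall>u\<in>S. central (u ^ i)" by (simp add: central_def)
    with minimal i show False by blast
  qed
  have frob: "(Y + 1) ^ k = Y ^ k + 1" for Y :: 'a
  proof -
    have "(Y + 1) ^ k = (\<Sum>i\<le>k. of_nat (k choose i) * Y ^ i)"
      using binomial_commuting[of Y 1 k] by simp
    also have "\<dots> = (\<Sum>i\<in>{0, k}. of_nat (k choose i) * Y ^ i)"
      using binom0 by (intro sum.mono_neutral_right) auto
    finally show ?thesis using k by (simp add: add.commute)
  qed
  \<comment> \<open>This makes the last term of the expansion of \<open>(ad u)\<^sup>k v\<close> equal to \<open>- v u\<^sup>k\<close>.\<close>
  have sign: "(- 1) ^ k = (- 1 :: 'a)"
    using frob[of "- 1"] k(1) by (simp add: eq_neg_iff_add_eq_0 power_0_left)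
  obtain u where u: "u \<in> S" using ne by blast
  have "u \<noteq> 0" using noncentral[OF u] by auto
  obtain v where v: "ad u v \<noteq> 0"
    using noncentral[OF u] by (auto simp: central_def ad_def)
  have "(ad u ^^ k) v = (\<Sum>j\<in>{0, k}. of_int ((- 1) ^ j * int (k choose j)) * (u ^ (k - j) * v * u ^ j))"
    unfolding ad_funpow using binom0 by (intro sum.mono_neutral_right) auto
  also have "\<dots> = u ^ k * v - v * u ^ k"
    using k(1) sign by simp
  finally have nil: "(ad u ^^ k) v = 0"
    using centralD[OF k(2)[OF u]] by simp
  define m where "m = (LEAST m. (ad u ^^ m) v = 0)"
  have m: "(ad u ^^ m) v = 0" "\<And>i. i < m \<Longrightarrow> (ad u ^^ i) v \<noteq> 0"
    unfolding m_def using LeastI[of "\<lambda>m. (ad u ^^ m) v = 0", OF nil] not_less_Least by blast+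
  have "m \<noteq> 0" "m \<noteq> 1" using m(1) v by (auto simp: ad_def intro: ccontr)
  then obtain l where l: "m = Suc (Suc l)" by (metis One_nat_def not0_implies_Suc)
  define r s where "r = (ad u ^^ l) v" and "s = (ad u ^^ Suc l) v"
  have rs: "u * r - r * u = s" by (simp add: r_def s_def ad_def)
  have "s \<noteq> 0" using m(2)[of "Suc l"] l by (simp add: s_def del: funpow.simps)
  moreover have "ad u s = 0" using m(1) unfolding l s_def by simp
  ultimately have s: "s \<noteq> 0" "u * s = s * u" by (simp_all add: ad_def)
  \<comment> \<open>\<open>s\<close> commutes with \<open>u\<close>, so the commutator of \<open>u\<close> with \<open>r s\<inverse> u\<close> is \<open>s s\<inverse> u = u\<close>.\<close>
  define w where "w = r * (inverse s * u)"
  have "u * w - w * u = (u * r - r * u) * (inverse s * u)"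
    using mult_commute_imp_mult_inverse_commute[OF s(2)[symmetric]]
    by (simp add: w_def left_diff_distrib mult.assoc)
  moreover have "s * (inverse s * u) = u" using s(1) by (simp flip: mult.assoc)
  ultimately have w: "u * w - w * u = u" by (simp only: rs)
  obtain Y where Y: "Y \<in> S" "u * Y - Y * u = u"
  proof (cases "w \<in> S")
    case False
    then have "w + u \<in> S" using big[OF u] by blast
    with that w show thesis by (simp add: algebra_simps)
  qed (use that w in blast)
  have conj: "(Y + 1) * u = u * Y" using Y(2) by (simp add: algebra_simps)
  have "(Y + 1) ^ i * u = u * Y ^ i" for i
  proof (induction i)
    case (Suc i)
    have "(Y + 1) ^ Suc i * u = (Y + 1) * ((Y + 1) ^ i * u)" by (simp only: power_Suc mult.assoc)
    also have "\<dots> = ((Y + 1) * u) * Y ^ i" unfolding Suc.IH by (simp only: mult.assoc)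
    also have "\<dots> = u * Y ^ Suc i"
      unfolding conj by (simp only: power_Suc mult.assoc)
    finally show ?case .
  qed simp
  then have "(Y ^ k + 1) * u = u * Y ^ k" using frob[of Y] by metis
  then have "u = 0" using centralD[OF k(2)[OF Y(1)], of u] by (simp add: distrib_right)
  with \<open>u \<noteq> 0\<close> show False ..
qed

text \<open>Since \<open>T x\<close> commutes with \<open>x\<close>, linearising gives that the commutator of \<open>T x\<close> and \<open>y\<close> is the commutator
of \<open>x\<close> and \<open>T y\<close>. For \<open>z x\<close> in place of \<open>x\<close> the latter is linear in \<open>z\<close>, so the coefficient of \<open>z\<^sup>k\<close>
in the former vanishes: \<open>x\<^sup>k\<close> is central for every \<open>x\<close>.\<close>

lemma middle_terms_not_additive_of_infinite_center:
  assumes inf: "infinite {z::'a::division_ring. central z}"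
    and noncomm: "\<exists>a b::'a. a * b \<noteq> b * a"
    and k: "2 \<le> k" "k < n" "(of_nat (n choose k) :: 'a) \<noteq> 0"
  shows "\<not> additive (middle_terms n :: 'a \<Rightarrow> 'a)"
proof
  assume add: "additive (middle_terms n :: 'a \<Rightarrow> 'a)"
  let ?T = "middle_terms n :: 'a \<Rightarrow> 'a"
  have n0: "n > 0" using k by simp
  have biadd: "?T x * y - y * ?T x = x * ?T y - ?T y * x" for x y
  proof -
    have "(?T x + ?T y) * (x + y) = (x + y) * (?T x + ?T y)"
      using middle_terms_commute[of "x + y" n] additive.add[OF add, of x y] by (simp only:)
    then have "?T x * x + ?T x * y + (?T y * x + ?T y * y) = x * ?T x + y * ?T x + (x * ?T y + y * ?T y)"
      by (simp only: distrib_left distrib_right add_ac)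
    then have "?T x * y + ?T y * x = y * ?T x + x * ?T y"
      unfolding middle_terms_commute by (simp add: add_ac)
    then show ?thesis by (simp add: algebra_simps)
  qed
  have pow: "central (x ^ k)" for x :: 'a
  proof -
    have "x ^ k * y - y * x ^ k = 0" for y
    proof -
      let ?g = "\<lambda>i. if i \<in> {1..<n} then of_nat (n choose i) * (x ^ i * y - y * x ^ i) else 0"
      let ?h = "\<lambda>i. if i = 1 then x * ?T y - ?T y * x else 0"
      have "(\<Sum>i\<le>n. z ^ i * (?g i - ?h i)) = 0" if z: "central z" for z
      proof -
        have "?T (z * x) * y - y * ?T (z * x) = (\<Sum>i\<le>n. z ^ i * ?g i)"
          unfolding middle_terms_central_mult[OF z n0]
            sum_distrib_left sum_distrib_right sum_subtractf[symmetric]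
        proof (intro sum.cong refl)
          fix i
          show "z ^ i * (if i \<in> {1..<n} then of_nat (n choose i) * x ^ i else 0) * y
              - y * (z ^ i * (if i \<in> {1..<n} then of_nat (n choose i) * x ^ i else 0)) = z ^ i * ?g i"
            by (simp add: central_left_commute[OF central_power[OF z], of y]
                central_left_commute[OF central_of_nat, of y] right_diff_distrib mult.assoc)
        qed
        moreover have "?T (z * x) * y - y * ?T (z * x) = z * (x * ?T y - ?T y * x)"
          unfolding biadd by (simp only: right_diff_distrib mult.assoc central_left_commute[OF z])
        moreover have "(\<Sum>i\<le>n. z ^ i * ?h i) = z * (x * ?T y - ?T y * x)"
          using k by (subst sum.mono_neutral_right[of _ "{1}"]) auto
        ultimately show ?thesis by (simp only: right_diff_distrib sum_subtractf diff_self)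
      qed
      then have "?g k - ?h k = 0"
        using central_vandermonde[OF inf, of "\<lambda>i. ?g i - ?h i" n k] k by simp
      with k show ?thesis by simp
    qed
    then show ?thesis by (simp add: central_def)
  qed
  show False
  proof (rule no_central_powers[OF inf, of "{u. \<not> central u}" k])
    show "{u::'a. \<not> central u} \<noteq> {}" using noncomm by (auto simp: central_def)
    show "u + z \<in> {u. \<not> central u}" if "u \<in> {u. \<not> central u}" "central z" for u z :: 'a
      using that central_diff[of "u + z" z] by auto
    show "y \<in> {u. \<not> central u} \<or> y + u \<in> {u. \<not> central u}" if "u \<in> {u. \<not> central u}" for u y :: 'a
      using that central_diff[of "y + u" y] by auto
  qed (use pow k in auto)
qed

text \<open>The map \<open>f\<close> vanishes at central elements, because \<open>T\<close> would be additive otherwise, and so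
\<open>2 f (z w) = T z (f w)\<close> for central \<open>z\<close>. Now suppose \<open>f u \<noteq> 0\<close>. Inserting \<open>z u\<close> into
\<open>f (x x) = T x (f x)\<close> shows that \<open>n = 0\<close> in the ring. Inserting \<open>u + z v\<close> then shows that the part of
\<open>T (u + z v)\<close> linear in \<open>z\<close> vanishes, hence that \<open>T u\<close> commutes with every \<open>v\<close>. Scaling \<open>u\<close> by central
elements singles out the power \<open>u\<^sup>k\<close>.\<close>

lemma additive_eq_0_of_infinite_center:
  fixes f :: "'a::division_ring \<Rightarrow> 'a"
  assumes inf: "infinite {z::'a. central z}"
    and two: "(2::'a) \<noteq> 0"
    and k: "2 \<le> k" "k < n" "(of_nat (n choose k) :: 'a) \<noteq> 0"
    and not_additive: "\<not> additive (middle_terms n :: 'a \<Rightarrow> 'a)"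
    and f: "additive f"
    and id: "\<And>x w. x * w = w * x \<Longrightarrow> f (x * x * w) = middle_terms n (x * w) * f x + x ^ n * f w"
  shows "f x = 0"
proof -
  let ?T = "middle_terms n :: 'a \<Rightarrow> 'a"
  note add = additive.add[OF f] and f0 = additive.zero[OF f]
  have n: "n > 2" using k by simp
  have collect: "(a - y0) + z * (- y1 + z * (p1 + p2 - y2 - y3)) = 0"
    if "a + x1 + x2 - (x3 + x4) = 0" "x1 = z * (z * p1)" "x2 = z * (z * p2)"
      "x3 = y0 + z * y1 + z * (z * y2)" "x4 = z * (z * y3)"
    for a x1 x2 x3 x4 y0 y1 y2 y3 p1 p2 z :: 'a
    using that by (simp add: algebra_simps)
  have collect': "0 + z * ((p - q) + z * (r * W - W * r)) = 0"
    if "(t + z * (z * r)) * W - W * (t + z * (z * r)) = 0" "W * (z * (z * r)) = z * (z * (W * r))"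
      "t * W = a + z * p" "W * t = a + z * q"
    for a t r p q z W :: 'a
    using that by (simp add: distrib_left distrib_right right_diff_distrib mult.assoc) (simp add: algebra_simps)
  have power_n: "y ^ n = y * (y * y ^ (n - 2))" for y :: 'a
  proof -
    have "n = Suc (Suc (n - 2))" using n by simp
    then have "y ^ n = y ^ Suc (Suc (n - 2))" by (rule arg_cong)
    then show ?thesis by simp
  qed
  have f_central: "f z = 0" if z: "central z" for z
  proof (rule ccontr)
    assume nz: "f z \<noteq> 0"
    then have z0: "z \<noteq> 0" using f0 by auto
    have T: "?T (z * w) = (f (z * z * w) - z ^ n * f w) * inverse (f z)" for w
      using id[of z w] centralD[OF z, of w] nz by (simp add: mult.assoc)
    have "?T w = (f (z * w) - z ^ n * f (inverse z * w)) * inverse (f z)" for w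
    proof -
      have "z * (inverse z * w) = w" "z * z * (inverse z * w) = z * w"
        using z0 by (simp_all flip: mult.assoc) (simp add: mult.assoc)
      with T[of "inverse z * w"] show ?thesis by (simp only:)
    qed
    then have T_eq: "?T = (\<lambda>w. (f (z * w) - z ^ n * f (inverse z * w)) * inverse (f z))" by (rule ext)
    have "additive ?T"
      unfolding T_eq by (simp add: additive_def distrib_left add algebra_simps)
    with not_additive show False ..
  qed
  have f_zzw: "f (z * z * w) = z ^ n * f w" if "central z" for z w
    using id[of z w] that f_central by (simp add: centralD)
  have f_zw: "2 * f (z * w) = ?T z * f w" if z: "central z" for z w
  proof -
    have "f (z * z * w) + 2 * f (z * w) + f w = f ((1 + z) * (1 + z) * w)"
      by (simp add: add distrib_left distrib_right mult_2 add_ac)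
    also have "\<dots> = (1 + z) ^ n * f w" by (intro f_zzw central_add z central_1)
    finally show ?thesis using f_zzw[OF z, of w] by (simp add: algebra_simps)
  qed
  have f_sq: "f (x * x) = ?T x * f x" for x
    using id[of x 1] f_central[OF central_1] by simp
  have T_poly: "central_poly (\<lambda>z. ?T (u + z * v))" for u v
    by (intro central_poly_intros)
  have two_central: "central (2::'a)" using central_of_nat[of 2] by simp
  have two_left: "2 * (a * b) = a * (2 * b)" for a b :: 'a
    using central_left_commute[OF two_central] by simp
  \<comment> \<open>Evaluate \<open>f ((z u)\<^sup>2)\<close> in two ways.\<close>
  have scale: "?T (z * u) * ?T z = 2 * z ^ n * ?T u" if u: "f u \<noteq> 0" and z: "central z" for u z
  proof -
    have "2 * z ^ n * ?T u * f u = 2 * (z ^ n * f (u * u))" by (simp add: f_sq mult.assoc)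
    also have "\<dots> = 2 * f (z * z * (u * u))" using f_zzw[OF z] by simp
    also have "z * z * (u * u) = (z * u) * (z * u)"
      using central_left_commute[OF z, of u u] by (simp add: mult.assoc)
    also have "2 * f \<dots> = ?T (z * u) * (2 * f (z * u))" by (simp only: f_sq two_left)
    also have "\<dots> = ?T (z * u) * ?T z * f u" by (simp only: f_zw[OF z] mult.assoc)
    finally show ?thesis using u by simp
  qed
  show "f x = 0"
  proof (rule ccontr)
    assume fx: "f x \<noteq> 0"
    then have "x \<noteq> 0" using f0 by auto
    have tail_poly: "central_poly (\<lambda>z. binom_tail n i (z * u))" for i u
      unfolding binom_tail_def by (intro central_poly_sum central_poly_intros) simp
    have T_tail: "?T y = y * binom_tail n 1 y" for y
      by (rule middle_terms_eq_tail) (use n in simp)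
    \<comment> \<open>The coefficient of \<open>z\<^sup>2\<close> in \<open>T (z x) T z\<close> is \<open>n\<^sup>2 x\<close>, while the other side of \<open>scale\<close> is a multiple
      of \<open>z\<^sup>n\<close> with \<open>n > 2\<close>.\<close>
    have char: "(of_nat n :: 'a) = 0"
    proof -
      let ?R = "\<lambda>z. x * binom_tail n 1 (z * x) * binom_tail n 1 (z * 1) - 2 * z ^ (n - 2) * ?T x"
      have R0: "?R z = 0" if "z \<in> {z. central z} - {0}" for z
      proof -
        have z: "central z" "z \<noteq> 0" using that by auto
        let ?p = "binom_tail n 1 (z * x)" and ?q = "binom_tail n 1 z"
        have "(z * x * ?p) * (z * ?q) = z * z * (x * ?p * ?q)"
          using central_left_commute[OF z(1), of "x * ?p" ?q] by (simp add: mult.assoc)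
        moreover have "2 * z ^ n * ?T x = z * z * (2 * z ^ (n - 2) * ?T x)"
          by (simp add: power_n[of z] mult.assoc central_left_commute[OF two_central, of z])
        ultimately have "z * z * ?R z = (z * x * ?p) * (z * ?q) - 2 * z ^ n * ?T x"
          by (simp add: right_diff_distrib)
        also have "\<dots> = 0" using scale[OF fx z(1)] by (simp only: T_tail[symmetric] diff_self)
        finally show ?thesis using z(2) by simp
      qed
      have R: "central_poly ?R"
        by (intro central_poly_intros tail_poly)
      have "?R 0 = 0"
        by (rule central_poly_eq_0[OF R _ _ R0 central_0, of "{z. central z} - {0}"])
          (use inf in auto)
      moreover have "binom_tail n 1 (0::'a) = of_nat n"
        using binom_tail_step[of 1 n 0] n by simp
      ultimately show ?thesis using n \<open>x \<noteq> 0\<close> by (simp add: power_0_left)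
    qed
    have T_central: "central (?T u)" if u: "f u \<noteq> 0" for u
    proof -
      have "?T u * v - v * ?T u = 0" for v
      proof -
        obtain b R where R: "central_poly R"
          and T: "\<And>z. central z \<Longrightarrow> ?T (u + z * v) = ?T u + z * (b + z * R z)"
        proof (rule central_poly_decomp[OF T_poly, of u v])
          fix b R
          assume R: "central_poly R" and G: "\<And>z. central z
            \<Longrightarrow> ?T (u + z * v) = ?T (u + 0 * v) + z * (b + z * R z)"
          show thesis by (rule that[OF R]) (simp only: G mult_zero_left add_0_right)
        qed
        \<comment> \<open>As \<open>n = 0\<close>, the polynomial \<open>T\<close> starts in degree two and does not contribute to the coefficient of \<open>z\<close>.\<close>
        have T2: "?T z = z * (z * binom_tail n 2 z)" for z
          using T_tail[of z] binom_tail_step[of 1 n z] n char by (simp add: numeral_2_eq_2)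
        have tail2: "central_poly (binom_tail n 2 :: 'a \<Rightarrow> 'a)"
          using tail_poly[of 2 1] by simp
        let ?Q = "\<lambda>z. binom_tail n 2 z * f (u * v + v * u) + 2 * z ^ (n - 2) * f (v * v)
          - R z * (2 * f u) - ?T (u + z * v) * (binom_tail n 2 z * f v)"
        have "(2 * f (u * u) - ?T u * (2 * f u)) + z * (- (b * (2 * f u)) + z * ?Q z) = 0"
          if z: "central z" for z
        proof -
          have "(u + z * v) * (u + z * v) = u * u + z * (u * v + v * u) + z * z * (v * v)"
            by (simp add: distrib_left distrib_right mult.assoc central_left_commute[OF z, of u]
                central_left_commute[OF z, of v] add_ac)
          then have "2 * f ((u + z * v) * (u + z * v))
              = 2 * f (u * u) + ?T z * f (u * v + v * u) + 2 * (z ^ n * f (v * v))"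
            by (simp only: add f_zw[OF z] f_zzw[OF z] distrib_left)
          moreover have "2 * f ((u + z * v) * (u + z * v)) = ?T (u + z * v) * (2 * f u + ?T z * f v)"
          proof -
            have "2 * f (u + z * v) = 2 * f u + ?T z * f v"
              by (simp only: add distrib_left f_zw[OF z])
            then show ?thesis unfolding f_sq two_left by (simp only:)
          qed
          ultimately have "2 * f (u * u) + ?T z * f (u * v + v * u) + 2 * (z ^ n * f (v * v))
              - (?T (u + z * v) * (2 * f u) + ?T (u + z * v) * (?T z * f v)) = 0"
            by (simp only: distrib_left diff_self)
          moreover have "?T z * f (u * v + v * u) = z * (z * (binom_tail n 2 z * f (u * v + v * u)))"
            unfolding T2[of z] by (simp only: mult.assoc)
          moreover have "2 * (z ^ n * f (v * v)) = z * (z * (2 * z ^ (n - 2) * f (v * v)))"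
            by (simp only: power_n[of z] mult.assoc central_left_commute[OF two_central, of z])
          moreover have "?T (u + z * v) * (2 * f u) = ?T u * (2 * f u) + z * (b * (2 * f u)) + z * (z * (R z * (2 * f u)))"
            unfolding T[OF z] by (simp only: distrib_left distrib_right mult.assoc add.assoc)
          moreover have "?T (u + z * v) * (?T z * f v) = z * (z * (?T (u + z * v) * (binom_tail n 2 z * f v)))"
            unfolding T2[of z] by (simp only: mult.assoc central_left_commute[OF z, of "?T (u + z * v)"])
          ultimately show ?thesis by (rule collect)
        qed
        from central_poly_constant_term_eq_0(2)[OF inf _ this]
        have "- (b * (2 * f u)) + z * ?Q z = 0" if "central z" for z
          using that R tail2 T_poly by (simp add: central_poly_intros)
        from central_poly_constant_term_eq_0(1)[OF inf _ this]
        have "- (b * (2 * f u)) = 0"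
          using R tail2 T_poly by (simp add: central_poly_intros)
        with u two have b: "b = 0" by simp
        \<comment> \<open>\<open>T (u + z v)\<close> commutes with \<open>u + z v\<close>; with \<open>b = 0\<close> the coefficient of \<open>z\<close> in the commutator is the
          commutator of \<open>T u\<close> and \<open>v\<close>.\<close>
        have "0 + z * ((?T u * v - v * ?T u) + z * (R z * (u + z * v) - (u + z * v) * R z)) = 0"
          if z: "central z" for z
        proof -
          have "?T (u + z * v) * (u + z * v) - (u + z * v) * ?T (u + z * v) = 0"
            by (simp only: middle_terms_commute diff_self)
          then have "(?T u + z * (z * R z)) * (u + z * v) - (u + z * v) * (?T u + z * (z * R z)) = 0"
            unfolding T[OF z] b by simp
          moreover have "(u + z * v) * (z * (z * R z)) = z * (z * ((u + z * v) * R z))"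
            by (simp only: central_left_commute[OF z, of "u + z * v"])
          moreover have "?T u * (u + z * v) = u * ?T u + z * (?T u * v)"
            by (simp only: distrib_left middle_terms_commute central_left_commute[OF z, of "?T u"])
          moreover have "(u + z * v) * ?T u = u * ?T u + z * (v * ?T u)"
            by (simp only: distrib_right mult.assoc)
          ultimately show ?thesis by (rule collect')
        qed
        from central_poly_constant_term_eq_0(2)[OF inf _ this]
        have "(?T u * v - v * ?T u) + z * (R z * (u + z * v) - (u + z * v) * R z) = 0" if "central z" for z
          using that R by (simp add: central_poly_intros)
        from central_poly_constant_term_eq_0(1)[OF inf _ this]
        show ?thesis using R by (simp add: central_poly_intros)
      qed
      then show ?thesis by (simp add: central_def)
    qed
    have pow: "central (u ^ k)" if u: "f u \<noteq> 0" for u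
    proof -
      \<comment> \<open>For \<open>z\<close> in \<open>A\<close> the element \<open>z u\<close> is again outside the kernel of \<open>f\<close>, so \<open>T (z u)\<close> is central.\<close>
      define A where "A = {z. central z \<and> ?T z \<noteq> 0}"
      let ?c = "\<lambda>(y::'a) i. if i \<in> {1..<n} then of_nat (n choose i) * y ^ i else 0"
      have "infinite A"
      proof
        assume "finite A"
        then have i1: "infinite ({z. central z} - A)" using inf by simp
        have i2: "(\<Sum>i\<le>n. z ^ i * ?c 1 i) = 0" if "z \<in> {z. central z} - A" for z
          using middle_terms_central_mult[of z n 1] that n by (simp add: A_def)
        have "?c 1 k = 0"
          by (rule central_vandermonde[of "{z. central z} - A" "?c 1" n k, OF i1 _ i2]) (use k in auto)
        with k show False by simp
      qed
      have "u ^ k * v - v * u ^ k = 0" for v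
      proof -
        let ?d = "\<lambda>i. ?c u i * v - v * ?c u i"
        have d: "(\<Sum>i\<le>n. z ^ i * ?d i) = 0" if "z \<in> A" for z
        proof -
          have z: "central z" "?T z \<noteq> 0" using that by (auto simp: A_def)
          then have "f (z * u) \<noteq> 0" using f_zw[OF z(1), of u] u by auto
          then have "?T (z * u) * v - v * ?T (z * u) = 0"
            using centralD[OF T_central, of "z * u" v] by simp
          moreover have "?T (z * u) = (\<Sum>i\<le>n. z ^ i * ?c u i)"
            using middle_terms_central_mult[OF z(1)] n by simp
          ultimately show ?thesis
            by (simp only: sum_distrib_left sum_distrib_right right_diff_distrib sum_subtractf
                mult.assoc central_left_commute[OF central_power[OF z(1)]])
        qed
        have "?d k = 0"
          by (rule central_vandermonde[of A ?d n k, OF \<open>infinite A\<close> _ d]) (use k in \<open>auto simp: A_def\<close>)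
        with k have "of_nat (n choose k) * (u ^ k * v - v * u ^ k) = 0"
          using central_left_commute[OF central_of_nat, of v "n choose k" "u ^ k"]
          by (simp add: right_diff_distrib mult.assoc)
        with k show ?thesis by simp
      qed
      then show ?thesis by (simp add: central_def)
    qed
    show False
    proof (rule no_central_powers[OF inf, of "{u. f u \<noteq> 0}" k])
      show "y \<in> {u. f u \<noteq> 0} \<or> y + u \<in> {u. f u \<noteq> 0}" if "u \<in> {u. f u \<noteq> 0}" for u y
        using that add[of y u] by auto
    qed (use fx f_central add pow k in auto)
  qed
qed

section \<open>Finite centre: an element of infinite order\<close>

lemma sum_powers_eq_0:
  fixes c :: "'a::division_ring"
  assumes "c ^ m = 1" "c \<noteq> 1" shows "(\<Sum>j<m. c ^ j) = 0"
proof -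
  have "(c - 1) * (\<Sum>j<m. c ^ j) = c ^ m - 1"
    by (induction m) (simp_all add: distrib_left left_diff_distrib)
  with assms show ?thesis by simp
qed

text \<open>A finite Fourier transform: \<open>w j = \<Sum> a\<^sup>-\<^sup>i\<^sup>j y a\<^sup>i\<close> satisfies \<open>w j a = a\<^sup>j w j\<close>, and the \<open>w j\<close> add up to
\<open>m y\<close>. If only those with \<open>a\<^sup>j = a\<close> were nonzero, \<open>y\<close> would commute with \<open>a\<close>. This plays the role of the
Skolem-Noether theorem.\<close>

lemma twisted_commutation:
  fixes a y :: "'a::division_ring"
  assumes m: "m > 0" "a ^ m = 1" "\<And>i. 0 < i \<Longrightarrow> i < m \<Longrightarrow> a ^ i \<noteq> 1" "(of_nat m :: 'a) \<noteq> 0"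
    and y: "y * a \<noteq> a * y"
  shows "\<exists>w j. w \<noteq> 0 \<and> w * a = a ^ j * w \<and> a ^ j \<noteq> a"
proof (rule ccontr)
  assume none: "\<not> ?thesis"
  define b where "b = inverse a"
  have a0: "a \<noteq> 0" using m(1,2) by (auto simp: power_0_left)
  have bm: "b ^ m = 1" using m(2) by (simp add: b_def power_inverse)
  have b1: "b ^ i \<noteq> 1" if "0 < i" "i < m" for i
    using m(3)[OF that] unfolding b_def power_inverse by (metis inverse_1 inverse_inverse_eq)
  define w where "w j = (\<Sum>i<m. b ^ (i * j) * y * a ^ i)" for j
  have w: "w j * a = a ^ j * w j" for j
  proof -
    let ?g = "\<lambda>i. b ^ (i * j) * y * a ^ i"
    have ab: "a ^ j * b ^ j = 1" using a0 by (simp add: b_def power_inverse)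
    have "w j * a = (\<Sum>i<m. a ^ j * ?g (Suc i))"
      unfolding w_def sum_distrib_right
    proof (intro sum.cong refl)
      fix i
      have "a ^ j * ?g (Suc i) = (a ^ j * b ^ j) * b ^ (i * j) * y * a ^ Suc i"
        by (simp add: power_add mult.assoc)
      then show "?g i * a = a ^ j * ?g (Suc i)"
        unfolding ab by (simp add: mult.assoc power_commutes)
    qed
    also have "\<dots> = a ^ j * (\<Sum>i<m. ?g (Suc i))" by (simp add: sum_distrib_left)
    also have "(\<Sum>i<m. ?g (Suc i)) + ?g 0 = (\<Sum>i<m. ?g i) + ?g m"
      using sum.lessThan_Suc[of ?g m] sum.lessThan_Suc_shift[of ?g m] by (simp add: add.commute)
    then have "(\<Sum>i<m. ?g (Suc i)) = w j"
      using m(2) bm by (simp add: w_def power_mult)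
    finally show ?thesis .
  qed
  have "w j * a = a * w j" for j
    using none w[of j] by (cases "w j = 0") auto
  then have "(\<Sum>j<m. w j) * a = a * (\<Sum>j<m. w j)"
    by (simp add: sum_distrib_left sum_distrib_right)
  moreover have "(\<Sum>j<m. w j) = of_nat m * y"
  proof -
    have "(\<Sum>j<m. w j) = (\<Sum>i<m. (\<Sum>j<m. (b ^ i) ^ j) * y * a ^ i)"
      unfolding w_def by (subst sum.swap) (simp add: sum_distrib_right power_mult)
    also have "\<dots> = (\<Sum>i\<in>{0}. (\<Sum>j<m. (b ^ i) ^ j) * y * a ^ i)"
    proof (rule sum.mono_neutral_right)
      show "\<forall>i\<in>{..<m} - {0}. (\<Sum>j<m. (b ^ i) ^ j) * y * a ^ i = 0"
      proof
        fix i assume i: "i \<in> {..<m} - {0}"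
        have "(b ^ i) ^ m = 1"
          by (metis bm mult.commute power_mult power_one)
        then show "(\<Sum>j<m. (b ^ i) ^ j) * y * a ^ i = 0"
          using sum_powers_eq_0[of "b ^ i" m] b1[of i] i by simp
      qed
    qed (use m in auto)
    finally show ?thesis by simp
  qed
  ultimately have "of_nat m * (y * a - a * y) = 0"
    using central_left_commute[OF central_of_nat, of a m y] by (simp add: right_diff_distrib mult.assoc)
  with m(4) y show False by simp
qed

lemma card_eq_card_fibre_mult_card_image:
  assumes "finite A" and "\<And>x. x \<in> A \<Longrightarrow> card {y \<in> A. f y = f x} = q"
  shows "card A = q * card (f ` A)"
proof -
  have "card A = (\<Sum>z\<in>f ` A. card {y \<in> A. f y = z})"
    using sum.image_gen[OF assms(1), of "\<lambda>_. 1::nat" f] by simp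
  also have "\<dots> = (\<Sum>z\<in>f ` A. q)"
    using assms(2) by (intro sum.cong) auto
  finally show ?thesis by simp
qed

text \<open>The heart of Wedderburn's theorem. Here \<open>F\<close> is a finite field on which conjugation by \<open>y\<close> acts as an
automorphism of order \<open>r\<close>. Write \<open>N e\<close> for the norm, so that \<open>(e y)\<^sup>r = N e y\<^sup>r\<close>. Hilbert's theorem 90
identifies the kernel of the norm with the image of \<open>c \<mapsto> c y c\<inverse> y\<inverse>\<close>, whose fibres are the cosets of
the fixed field. Counting shows that the norm maps onto the nonzero fixed elements. Hence some
\<open>z = e y\<close> has \<open>z\<^sup>r = 1\<close> and \<open>z \<noteq> 1\<close>, so \<open>\<Sum>\<^bsub>j < r\<^esub> z\<^sup>j = 0\<close>. This contradicts the independence of the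
powers of \<open>z\<close> over \<open>F\<close>, which is extracted by averaging over conjugation with the powers of \<open>a\<close>.\<close>

lemma no_finite_cyclic_extension:
  fixes F :: "'a::division_ring set"
  assumes fin: "finite F" and F0: "0 \<in> F" and F1: "1 \<in> F"
    and F_add: "\<And>x y. x \<in> F \<Longrightarrow> y \<in> F \<Longrightarrow> x + y \<in> F"
    and F_mult: "\<And>x y. x \<in> F \<Longrightarrow> y \<in> F \<Longrightarrow> x * y \<in> F"
    and F_inv: "\<And>x. x \<in> F \<Longrightarrow> inverse x \<in> F"
    and F_comm: "\<And>x y. x \<in> F \<Longrightarrow> y \<in> F \<Longrightarrow> x * y = y * x"
    and y0: "y \<noteq> 0" and conj: "\<And>x. x \<in> F \<Longrightarrow> y * x * inverse y \<in> F"
    and r: "2 \<le> r" and b: "y ^ r \<in> F"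
    and a: "a \<in> F" "a ^ m = 1" "(of_nat m :: 'a) \<noteq> 0"
    and free: "\<And>j. 0 < j \<Longrightarrow> j < r \<Longrightarrow> y ^ j * a \<noteq> a * y ^ j"
  shows False
proof -
  have m0: "m \<noteq> 0" using a(3) by (metis of_nat_0)
  have a0: "a \<noteq> 0" using a(2) m0 by (auto simp: power_0_left)
  have F_sum: "(\<Sum>i\<in>I. g i) \<in> F" if "\<And>i. i \<in> I \<Longrightarrow> g i \<in> F" for I and g :: "nat \<Rightarrow> 'a"
    using that by (induction I rule: infinite_finite_induct) (simp_all add: F0 F_add)
  have F_pow: "x ^ i \<in> F" if "x \<in> F" for x i
    using that by (induction i) (simp_all add: F1 F_mult)
  define \<sigma> where "\<sigma> j x = y ^ j * x * inverse y ^ j" for j x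
  have yy: "y ^ j * inverse y ^ j = 1" "inverse y ^ j * y ^ j = 1" for j
    using y0 by (simp_all add: power_inverse)
  have yy': "y ^ j * (inverse y ^ j * x) = x" "inverse y ^ j * (y ^ j * x) = x" for j x
    by (simp_all add: yy flip: mult.assoc)
  have iyy: "inverse y * (y * x) = x" for x
    using y0 by (simp flip: mult.assoc)
  have \<sigma>_Suc: "\<sigma> (Suc j) x = y * \<sigma> j x * inverse y" for j x
    by (simp add: \<sigma>_def mult.assoc power_commutes)
  have \<sigma>_F: "\<sigma> j x \<in> F" if "x \<in> F" for j x
  proof (induction j)
    case 0 then show ?case using that by (simp add: \<sigma>_def)
  next
    case (Suc j) then show ?case unfolding \<sigma>_Suc by (rule conj)
  qed
  have \<sigma>_mult: "\<sigma> j (x * x') = \<sigma> j x * \<sigma> j x'" for j x x'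
    by (simp only: \<sigma>_def mult.assoc yy')
  have \<sigma>_pow: "\<sigma> j (x ^ k) = \<sigma> j x ^ k" for j x k
    by (induction k) (simp_all add: \<sigma>_mult, simp add: \<sigma>_def yy)
  have \<sigma>_y: "y ^ j * x = \<sigma> j x * y ^ j" for j x
    by (simp add: \<sigma>_def mult.assoc yy)
  \<comment> \<open>\<open>M j e\<close> is the partial norm \<open>e (\<sigma> e) \<dots> (\<sigma>\<^sup>j\<^sup>-\<^sup>1 e)\<close>, and \<open>M r\<close> is the norm.\<close>
  define M where "M j e = (e * y) ^ j * inverse y ^ j" for j e
  have M_Suc: "M (Suc j) e = e * (y * M j e * inverse y)" for j e
    by (simp add: M_def mult.assoc power_commutes)
  have M_F: "M j e \<in> F" if "e \<in> F" for j e
    by (induction j) (simp_all add: M_Suc, simp_all add: M_def F1 F_mult conj that)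
  have M_y: "(e * y) ^ j = M j e * y ^ j" for j e
    by (simp add: M_def mult.assoc yy)
  have M_mult: "M j (e * e') = M j e * M j e'" if e: "e \<in> F" "e' \<in> F" for j e e'
  proof (induction j)
    case 0 then show ?case by (simp add: M_def)
  next
    case (Suc j)
    have M1: "M (Suc j) d = d * \<sigma> 1 (M j d)" for d
      by (simp add: M_Suc \<sigma>_def)
    have "e' * \<sigma> 1 (M j e) = \<sigma> 1 (M j e) * e'"
      by (intro F_comm \<sigma>_F M_F e)
    then have "e * (e' * \<sigma> 1 (M j e)) * \<sigma> 1 (M j e') = e * (\<sigma> 1 (M j e) * e') * \<sigma> 1 (M j e')"
      by (simp only:)
    then show ?case
      unfolding M1 Suc.IH \<sigma>_mult by (simp only: mult.assoc)
  qed
  \<comment> \<open>Orthogonality of the characters \<open>k \<mapsto> \<sigma> j a ^ k\<close>.\<close>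
  have orth: "(\<Sum>k<m. inverse a ^ k * \<sigma> j a ^ k) = (if j = 0 then of_nat m else 0)" if "j < r" for j
  proof -
    let ?q = "inverse a * \<sigma> j a"
    have ca: "inverse a * \<sigma> j a = \<sigma> j a * inverse a" by (intro F_comm F_inv \<sigma>_F a)
    have q: "inverse a ^ k * \<sigma> j a ^ k = ?q ^ k" for k
      using power_mult_commuting[OF ca] by simp
    show ?thesis
    proof (cases "j = 0")
      case True
      then have "?q = 1" using a0 by (simp add: \<sigma>_def)
      with True show ?thesis unfolding q by simp
    next
      case False
      have "?q \<noteq> 1"
      proof
        assume "?q = 1"
        then have "\<sigma> j a = a" using a0 by (metis inverse_unique inverse_inverse_eq)
        then have "y ^ j * a = a * y ^ j" using \<sigma>_y[of j a] by simp
        with free[of j] False that show False by simp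
      qed
      moreover have "?q ^ m = 1"
        using q[of m] \<sigma>_pow[of j a m] a(2) by (simp add: power_inverse) (simp add: \<sigma>_def yy)
      ultimately show ?thesis using False by (simp add: q sum_powers_eq_0)
    qed
  qed
  have b_comm: "y ^ r * x = x * y ^ r" if "x \<in> F" for x
    using F_comm[OF b that] .
  have M_nz: "M j e \<noteq> 0" if "e \<noteq> 0" for j e
    using that y0 by (simp add: M_def)
  have N_fixed: "M r e * y = y * M r e" if e: "e \<in> F" "e \<noteq> 0" for e
  proof -
    have "(e * y) * (M r e * y ^ r) = (M r e * y ^ r) * (e * y)"
      unfolding M_y[symmetric] by (simp only: power_commutes)
    also have "\<dots> = M r e * (y ^ r * e) * y" by (simp only: mult.assoc)
    also have "\<dots> = (M r e * e) * y * y ^ r"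
      unfolding b_comm[OF e(1)] by (simp only: mult.assoc power_commutes)
    also have "M r e * e = e * M r e" by (intro F_comm M_F e)
    finally have "e * (y * M r e) * y ^ r = e * (M r e * y) * y ^ r" by (simp only: mult.assoc)
    with e y0 show ?thesis by simp
  qed
  define \<psi> where "\<psi> c = c * y * inverse c * inverse y" for c
  have \<psi>_y: "\<psi> c * y = c * y * inverse c" for c
    using y0 by (simp add: \<psi>_def mult.assoc)
  have \<psi>_eqI: "e = \<psi> c" if "e * y = c * y * inverse c" for e c
    using that y0 unfolding \<psi>_y[symmetric] by simp
  have hilbert90: "\<exists>c\<in>F - {0}. e = \<psi> c" if e: "e \<in> F" "M r e = 1" for e
  proof -
    \<comment> \<open>The Lagrange resolvent: \<open>e y\<close> and \<open>y\<close> are intertwined by \<open>C x\<close> as soon as \<open>C x \<noteq> 0\<close>.\<close>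
    define C where "C x = (\<Sum>j<r. M j e * \<sigma> j x)" for x
    have C_F: "C x \<in> F" if "x \<in> F" for x
      unfolding C_def by (intro F_sum F_mult M_F \<sigma>_F e that)
    have C_shift: "e * y * C x * inverse y = C x" if x: "x \<in> F" for x
    proof -
      let ?h = "\<lambda>j. M j e * \<sigma> j x"
      have h: "e * y * ?h j * inverse y = ?h (Suc j)" for j
        unfolding M_Suc \<sigma>_Suc by (simp only: mult.assoc iyy)
      have "?h r = ?h 0"
        using b_comm[OF x] by (simp add: e(2) \<sigma>_def mult.assoc yy) (simp add: M_def)
      moreover have "(\<Sum>j<r. ?h (Suc j)) + ?h 0 = (\<Sum>j<r. ?h j) + ?h r"
        using sum.lessThan_Suc[of ?h r] sum.lessThan_Suc_shift[of ?h r] by (simp add: add.commute)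
      ultimately have "(\<Sum>j<r. ?h (Suc j)) = C x" by (simp add: C_def)
      then show ?thesis
        unfolding h[symmetric] C_def by (simp add: sum_distrib_left sum_distrib_right)
    qed
    \<comment> \<open>Averaging \<open>C (a\<^sup>k) a\<^sup>-\<^sup>k\<close> over \<open>k\<close> isolates the summand \<open>j = 0\<close>, which is nonzero.\<close>
    have "\<exists>k. C (a ^ k) \<noteq> 0"
    proof (rule ccontr)
      assume "\<not> ?thesis"
      then have "0 = (\<Sum>k<m. C (a ^ k) * inverse a ^ k)" by simp
      also have "\<dots> = (\<Sum>j<r. M j e * (\<Sum>k<m. inverse a ^ k * \<sigma> j a ^ k))"
      proof -
        have "\<sigma> j a ^ k * inverse a ^ k = inverse a ^ k * \<sigma> j a ^ k" for j k
          by (intro F_comm F_pow F_inv \<sigma>_F a)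
        then show ?thesis
          unfolding C_def \<sigma>_pow sum_distrib_right sum_distrib_left
          by (subst sum.swap) (simp add: mult.assoc)
      qed
      also have "\<dots> = (\<Sum>j<r. if j = 0 then of_nat m else 0)"
        using orth by (intro sum.cong) (auto simp: M_def)
      also have "\<dots> = of_nat m" using r by simp
      finally show False using a(3) by simp
    qed
    then obtain k where k: "C (a ^ k) \<noteq> 0" by blast
    let ?c = "C (a ^ k)"
    have "e * y * ?c = e * y * ?c * inverse y * y" using y0 by (simp add: mult.assoc)
    then have "e * y * ?c = ?c * y" using C_shift[OF F_pow[OF a(1)]] by simp
    then have "e * y * ?c * inverse ?c = ?c * y * inverse ?c" by simp
    then have "e * y = ?c * y * inverse ?c" using k by (simp add: mult.assoc)
    then have "e = \<psi> ?c" by (rule \<psi>_eqI)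
    with k C_F[OF F_pow[OF a(1)]] show ?thesis by blast
  qed
  have \<psi>_F: "\<psi> c \<in> F - {0}" if "c \<in> F - {0}" for c
  proof -
    have "c * (y * inverse c * inverse y) \<in> F"
      using that by (intro F_mult conj F_inv) auto
    then show ?thesis using that y0 by (simp add: \<psi>_def mult.assoc)
  qed
  have \<psi>_norm: "M r (\<psi> c) = 1" if c: "c \<in> F - {0}" for c
  proof -
    have "(c * y * inverse c) ^ i = c * y ^ i * inverse c" for i
    proof (induction i)
      case (Suc i)
      have "(c * y * inverse c) ^ Suc i = c * y * (inverse c * c) * y ^ i * inverse c"
        by (simp only: power_Suc Suc.IH) (simp only: mult.assoc)
      also have "inverse c * c = 1" using c by simp
      finally show ?case by (simp only: power_Suc mult_1_right mult.assoc)
    qed (use c in simp)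
    then have "(\<psi> c * y) ^ r = c * (y ^ r * inverse c)"
      by (simp add: \<psi>_y mult.assoc)
    also have "y ^ r * inverse c = inverse c * y ^ r" using c by (intro b_comm F_inv) auto
    finally show ?thesis using c by (simp add: M_def mult.assoc[symmetric]) (simp add: yy)
  qed
  define Fs where "Fs = F - {0}"
  define K where "K = {x \<in> Fs. x * y = y * x}"
  define E where "E = {e \<in> Fs. M r e = 1}"
  have fin_Fs: "finite Fs" using fin by (simp add: Fs_def)
  have Fs_mult: "x * x' \<in> Fs" if "x \<in> Fs" "x' \<in> Fs" for x x'
    using that F_mult by (auto simp: Fs_def)
  have Fs_inv: "inverse x \<in> Fs" if "x \<in> Fs" for x
    using that F_inv by (auto simp: Fs_def)
  \<comment> \<open>The fibres of \<open>\<psi>\<close> are cosets of the fixed elements \<open>K\<close>, those of the norm are cosets of its kernel \<open>E\<close>.\<close>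
  have coset: "card ((\<lambda>k. c * k) ` A) = card A" if "c \<in> Fs" for c A
    using that by (intro card_image) (auto simp: inj_on_def Fs_def)
  have E_image: "\<psi> ` Fs = E"
    using hilbert90 \<psi>_F \<psi>_norm by (auto simp: E_def Fs_def)
  have "card Fs = card K * card (\<psi> ` Fs)"
  proof (rule card_eq_card_fibre_mult_card_image[OF fin_Fs])
    fix c assume c: "c \<in> Fs"
    have eq: "\<psi> (c * k) = \<psi> c \<longleftrightarrow> k * y = y * k" if k: "k \<in> Fs" for k
    proof -
      have nz: "c \<noteq> 0" "k \<noteq> 0" using c k by (auto simp: Fs_def)
      have "\<psi> (c * k) = \<psi> c \<longleftrightarrow> \<psi> (c * k) * y = \<psi> c * y" using y0 by simp
      also have "\<dots> \<longleftrightarrow> c * ((k * y * inverse k) * inverse c) = c * (y * inverse c)"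
        unfolding \<psi>_y using nz by (simp add: nonzero_inverse_mult_distrib mult.assoc)
      also have "\<dots> \<longleftrightarrow> k * y * inverse k = y" using nz by simp
      also have "\<dots> \<longleftrightarrow> k * y * inverse k * k = y * k" using nz by simp
      also have "\<dots> \<longleftrightarrow> k * y = y * k" using nz by (simp add: mult.assoc)
      finally show ?thesis .
    qed
    have "{c' \<in> Fs. \<psi> c' = \<psi> c} = (\<lambda>k. c * k) ` K"
    proof (intro equalityI subsetI)
      fix c' assume c': "c' \<in> {c' \<in> Fs. \<psi> c' = \<psi> c}"
      have c'_eq: "c' = c * (inverse c * c')" using c by (simp add: Fs_def flip: mult.assoc)
      have "inverse c * c' \<in> Fs" using c c' Fs_mult Fs_inv by blast
      with eq[OF this] c' c'_eq show "c' \<in> (\<lambda>k. c * k) ` K"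
        by (intro image_eqI[of c' "\<lambda>k. c * k" "inverse c * c'"]) (simp_all add: K_def)
    qed (use eq c Fs_mult in \<open>auto simp: K_def\<close>)
    then show "card {c' \<in> Fs. \<psi> c' = \<psi> c} = card K" using coset[OF c] by simp
  qed
  moreover have "card Fs = card E * card (M r ` Fs)"
  proof (rule card_eq_card_fibre_mult_card_image[OF fin_Fs])
    fix e assume e: "e \<in> Fs"
    have eq: "M r (e * k) = M r e \<longleftrightarrow> M r k = 1" if k: "k \<in> Fs" for k
      using M_mult[of e k r] M_nz[of e r] e k by (auto simp: Fs_def)
    have "{e' \<in> Fs. M r e' = M r e} = (\<lambda>k. e * k) ` E"
    proof (intro equalityI subsetI)
      fix e' assume e': "e' \<in> {e' \<in> Fs. M r e' = M r e}"
      have e'_eq: "e' = e * (inverse e * e')" using e by (simp add: Fs_def flip: mult.assoc)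
      have "inverse e * e' \<in> Fs" using e e' Fs_mult Fs_inv by blast
      with eq[OF this] e' e'_eq show "e' \<in> (\<lambda>k. e * k) ` E"
        by (intro image_eqI[of e' "\<lambda>k. e * k" "inverse e * e'"]) (simp_all add: E_def)
    qed (use eq e Fs_mult in \<open>auto simp: E_def\<close>)
    then show "card {e' \<in> Fs. M r e' = M r e} = card E" using coset[OF e] by simp
  qed
  moreover have "card E > 0"
  proof -
    have "1 \<in> E" using F1 y0 by (simp add: E_def Fs_def M_def yy)
    then show ?thesis using fin_Fs by (auto simp: E_def card_gt_0_iff)
  qed
  ultimately have "card (M r ` Fs) = card K" unfolding E_image by simp
  moreover have "M r ` Fs \<subseteq> K"
    using M_F M_nz N_fixed by (auto simp: K_def Fs_def)
  moreover have "finite K" using fin_Fs by (simp add: K_def)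
  ultimately have surj: "M r ` Fs = K" by (simp add: card_subset_eq)
  have "inverse (y ^ r) * y = y * inverse (y ^ r)"
    by (metis mult_commute_imp_mult_inverse_commute power_commutes)
  then have "inverse (y ^ r) \<in> K" using b F_inv y0 by (simp add: K_def Fs_def)
  then obtain e where e: "e \<in> Fs" "M r e = inverse (y ^ r)" using surj by (metis imageE)
  define z where "z = e * y"
  have zr: "z ^ r = 1" using M_y[of e r] e(2) y0 by (simp add: z_def)
  have "z \<noteq> 1"
  proof
    assume "z = 1"
    then have "y = inverse e" unfolding z_def by (metis inverse_unique)
    then have "y \<in> F" using e F_inv by (simp add: Fs_def)
    then have "y ^ 1 * a = a * y ^ 1" using F_comm a by simp
    with free[of 1] r show False by simp
  qed
  then have "0 = (\<Sum>k<m. inverse a ^ k * (\<Sum>j<r. z ^ j) * a ^ k)"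
    using sum_powers_eq_0[OF zr] by simp
  also have "\<dots> = (\<Sum>j<r. M j e * (\<Sum>k<m. inverse a ^ k * \<sigma> j a ^ k) * y ^ j)"
  proof -
    have "inverse a ^ k * z ^ j * a ^ k = M j e * (inverse a ^ k * \<sigma> j a ^ k) * y ^ j" for j k
    proof -
      have "inverse a ^ k * M j e = M j e * inverse a ^ k"
        using e by (intro F_comm F_pow F_inv M_F a) (auto simp: Fs_def)
      moreover have "inverse a ^ k * z ^ j * a ^ k = (inverse a ^ k * M j e) * (y ^ j * a ^ k)"
        by (simp only: z_def M_y mult.assoc)
      ultimately show ?thesis by (simp only: \<sigma>_y \<sigma>_pow mult.assoc)
    qed
    then show ?thesis
      unfolding sum_distrib_right sum_distrib_left by (subst sum.swap) simp
  qed
  also have "\<dots> = (\<Sum>j<r. if j = 0 then of_nat m else 0)"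
    using orth by (intro sum.cong) (auto simp: M_def)
  also have "\<dots> = of_nat m" using r by simp
  finally show False using a(3) by simp
qed

lemma prime_CHAR_division_ring:
  assumes "CHAR('a::division_ring) > 0" shows "prime CHAR('a)"
  unfolding prime_nat_iff
proof (intro conjI allI impI)
  show "1 < CHAR('a)" using assms CHAR_not_1[where ?'a = 'a] by linarith
  fix m assume "m dvd CHAR('a)"
  then obtain d where d: "CHAR('a) = m * d" by blast
  have "(of_nat m * of_nat d :: 'a) = 0" using of_nat_CHAR[where ?'a = 'a] by (simp add: d)
  then have "CHAR('a) dvd m \<or> CHAR('a) dvd d" by (simp add: of_nat_eq_0_iff_char_dvd)
  moreover have "m > 0" "d > 0" using assms d by auto
  ultimately show "m = 1 \<or> m = CHAR('a)" using d
    by (metis dvd_imp_le dvd_antisym dvd_triv_left dvd_triv_right mult_cancel2 mult_1 not_gr0)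
qed

text \<open>By the binomial theorem \<open>(u - 1) ^ p = u ^ p - 1\<close> in characteristic \<open>p\<close>.\<close>

lemma root_of_unity_of_char_order:
  fixes u :: "'a::division_ring"
  assumes p: "CHAR('a) > 0" and u: "u ^ CHAR('a) = 1"
  shows "u = 1"
proof -
  let ?p = "CHAR('a)"
  have "((u - 1) + 1) ^ ?p = (\<Sum>i\<le>?p. of_nat (?p choose i) * (u - 1) ^ i)"
    using binomial_commuting[of "u - 1" 1 ?p] by simp
  also have "\<dots> = (\<Sum>i\<in>{0, ?p}. of_nat (?p choose i) * (u - 1) ^ i)"
    using dvd_choose_prime[OF _ _ _ prime_CHAR_division_ring[OF p]] p
    by (intro sum.mono_neutral_right) (auto simp: of_nat_eq_0_iff_char_dvd)
  also have "\<dots> = 1 + (u - 1) ^ ?p" using p by simp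
  finally have "(u - 1) ^ ?p = 0" using u by simp
  then show ?thesis by simp
qed

text \<open>The order of \<open>a\<close> is nonzero in the ring, because a factor \<open>p\<close> of the order could be removed by the
previous lemma. Fourier inversion divides by it.\<close>

lemma finite_order_obtain:
  fixes a :: "'a::division_ring"
  assumes p: "CHAR('a) > 0" and "k > 0" "a ^ k = 1"
  obtains m where "m > 0" "a ^ m = 1" "\<And>i. 0 < i \<Longrightarrow> i < m \<Longrightarrow> a ^ i \<noteq> 1" "(of_nat m :: 'a) \<noteq> 0"
proof -
  define m where "m = (LEAST m. m > 0 \<and> a ^ m = 1)"
  have m: "m > 0" "a ^ m = 1"
    using LeastI[of "\<lambda>m. m > 0 \<and> a ^ m = 1" k] assms unfolding m_def by auto
  have least: "a ^ i \<noteq> 1" if "0 < i" "i < m" for i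
    using not_less_Least[of i "\<lambda>m. m > 0 \<and> a ^ m = 1"] that unfolding m_def by auto
  have "(of_nat m :: 'a) \<noteq> 0"
  proof
    assume "(of_nat m :: 'a) = 0"
    then obtain d where d: "m = CHAR('a) * d" by (auto simp: of_nat_eq_0_iff_char_dvd)
    then have "(a ^ d) ^ CHAR('a) = 1" using m(2) by (simp add: mult.commute flip: power_mult)
    then have "a ^ d = 1" by (rule root_of_unity_of_char_order[OF p])
    moreover have "1 < CHAR('a)" using p CHAR_not_1[where ?'a = 'a] by linarith
    ultimately show False using least[of d] d m(1) by (cases "d = 0") auto
  qed
  with that m least show thesis by blast
qed

text \<open>In positive characteristic this is the additive subgroup generated by \<open>G\<close>, and it is finite when \<open>G\<close> is.\<close>

definition nat_span :: "'a::semiring_1 set \<Rightarrow> 'a set" where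
  "nat_span G = range (\<lambda>k. \<Sum>g\<in>G. of_nat (k g) * g)"

lemma nat_span_add: "x \<in> nat_span G \<Longrightarrow> y \<in> nat_span G \<Longrightarrow> x + y \<in> nat_span G"
proof -
  assume "x \<in> nat_span G" "y \<in> nat_span G"
  then obtain k l where "x = (\<Sum>g\<in>G. of_nat (k g) * g)" "y = (\<Sum>g\<in>G. of_nat (l g) * g)"
    unfolding nat_span_def by blast
  then have "x + y = (\<Sum>g\<in>G. of_nat (k g + l g) * g)"
    by (simp add: distrib_right sum.distrib)
  then show ?thesis unfolding nat_span_def by (rule range_eqI[of _ _ "\<lambda>g. k g + l g"])
qed

lemma nat_span_0: "0 \<in> nat_span G"
  unfolding nat_span_def by (rule range_eqI[of _ _ "\<lambda>_. 0"]) simp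

lemma nat_span_base:
  assumes "finite G" "g \<in> G" shows "g \<in> nat_span G"
proof -
  have "(\<Sum>h\<in>G. of_nat (if h = g then 1 else 0) * h) = (\<Sum>h\<in>G. if h = g then h else 0)"
    by (intro sum.cong) auto
  also have "\<dots> = g" using assms by simp
  finally show ?thesis
    unfolding nat_span_def by (intro range_eqI[of _ _ "\<lambda>h. if h = g then 1 else 0"]) (rule sym)
qed

lemma nat_span_induct [consumes 1, case_names zero add base]:
  assumes "x \<in> nat_span G" and "P 0" and add: "\<And>x y. P x \<Longrightarrow> P y \<Longrightarrow> P (x + y)"
    and base: "\<And>g. g \<in> G \<Longrightarrow> P g"
  shows "P x"
proof -
  have scale: "P (of_nat m * g)" if "g \<in> G" for m g
    by (induction m) (simp_all add: assms(2) add base that distrib_right)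
  have "P (\<Sum>g\<in>H. of_nat (k g) * g)" if "H \<subseteq> G" for H k
    using that
    by (induction H rule: infinite_finite_induct) (simp_all add: assms(2) add scale)
  then show ?thesis using assms(1) unfolding nat_span_def by auto
qed

lemma finite_nat_span:
  fixes G :: "'a::ring_1 set"
  assumes p: "CHAR('a) > 0" and "finite G"
  shows "finite (nat_span G)"
proof -
  let ?s = "\<lambda>k. \<Sum>g\<in>G. of_nat (k g) * g"
  have "nat_span G \<subseteq> ?s ` (\<Pi>\<^sub>E g\<in>G. {..<CHAR('a)})"
  proof
    fix x assume "x \<in> nat_span G"
    then obtain k where x: "x = ?s k" unfolding nat_span_def by blast
    have "(of_nat (k g mod CHAR('a)) :: 'a) = of_nat (k g)" for g
    proof -
      have "(of_nat (k g) :: 'a) = of_nat (CHAR('a) * (k g div CHAR('a)) + k g mod CHAR('a))"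
        by simp
      then show ?thesis by (simp only: of_nat_add of_nat_mult of_nat_CHAR) simp
    qed
    then have "x = ?s (restrict (\<lambda>g. k g mod CHAR('a)) G)"
      unfolding x by (intro sum.cong) auto
    moreover have "restrict (\<lambda>g. k g mod CHAR('a)) G \<in> (\<Pi>\<^sub>E g\<in>G. {..<CHAR('a)})"
      using p by auto
    ultimately show "x \<in> ?s ` (\<Pi>\<^sub>E g\<in>G. {..<CHAR('a)})" by blast
  qed
  then show ?thesis using assms(2) by (meson finite_PiE finite_imageI finite_lessThan finite_subset)
qed

lemma nat_span_mult:
  fixes G :: "'a::semiring_1 set"
  assumes fin: "finite G" and G: "\<And>g h. g \<in> G \<Longrightarrow> h \<in> G \<Longrightarrow> g * h \<in> G"
    and "x \<in> nat_span G" "y \<in> nat_span G"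
  shows "x * y \<in> nat_span G"
  using assms(3)
proof (induction x rule: nat_span_induct)
  case (base g)
  show ?case using assms(4)
    by (induction y rule: nat_span_induct)
      (simp_all add: nat_span_0 nat_span_add distrib_left G base nat_span_base[OF fin])
qed (simp_all add: nat_span_0 nat_span_add distrib_right)

lemma nat_span_commute:
  fixes G :: "'a::semiring_1 set"
  assumes G: "\<And>g h. g \<in> G \<Longrightarrow> h \<in> G \<Longrightarrow> g * h = h * g"
    and "x \<in> nat_span G" "y \<in> nat_span G"
  shows "x * y = y * x"
  using assms(2)
proof (induction x rule: nat_span_induct)
  case (base g)
  show ?case using assms(3)
    by (induction y rule: nat_span_induct) (simp_all add: distrib_left distrib_right G base)
qed (simp_all add: distrib_left distrib_right)

lemma finite_mult_closed_inverse:
  fixes F :: "'a::division_ring set"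
  assumes "finite F" "0 \<in> F" "1 \<in> F" and mult: "\<And>x y. x \<in> F \<Longrightarrow> y \<in> F \<Longrightarrow> x * y \<in> F"
    and x: "x \<in> F"
  shows "inverse x \<in> F"
proof (cases "x = 0")
  case False
  have "(\<lambda>y. x * y) ` F = F"
    using assms False by (intro endo_inj_surj) (auto simp: inj_on_def)
  then obtain y where "y \<in> F" "x * y = 1" using \<open>1 \<in> F\<close> by (metis imageE)
  then show ?thesis by (metis inverse_unique)
qed (use assms in simp)

text \<open>If every nonzero element had finite order, twisted commutation would give \<open>w a = a\<^sup>j w\<close> with
\<open>a\<^sup>j \<noteq> a\<close>. With \<open>r\<close> least such that \<open>b = w\<^sup>r\<close> commutes with \<open>a\<close>, the span of the elements \<open>a\<^sup>i b\<^sup>l\<close> is a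
finite field normalised by \<open>w\<close>, which is impossible by \<open>no_finite_cyclic_extension\<close>.\<close>

lemma exists_infinite_order:
  assumes fin: "finite {z::'a::division_ring. central z}"
    and noncomm: "\<exists>a b::'a. a * b \<noteq> b * a"
  shows "\<exists>t::'a. t \<noteq> 0 \<and> (\<forall>k>0. t ^ k \<noteq> 1)"
proof (rule ccontr)
  assume "\<not> ?thesis"
  then have torsion: "\<exists>k>0. t ^ k = 1" if "t \<noteq> 0" for t :: 'a using that by blast
  have p: "CHAR('a) > 0"
  proof -
    have "\<not> inj (of_nat :: nat \<Rightarrow> 'a)"
      using finite_imageD[of "of_nat :: nat \<Rightarrow> 'a" UNIV] finite_subset[OF _ fin, of "range of_nat"]
      by (auto simp: image_subset_iff)
    then obtain i j where ij: "of_nat i = (of_nat j :: 'a)" "i < j"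
      unfolding inj_def by (metis linorder_neqE_nat)
    then have "(of_nat (j - i) :: 'a) = 0" by (simp add: of_nat_diff)
    with ij show ?thesis unfolding CHAR_pos_iff by (intro exI[of _ "j - i"]) simp
  qed
  obtain a y where ay: "y * a \<noteq> a * (y :: 'a)" using noncomm by blast
  then have "a \<noteq> 0" by auto
  then obtain k where "k > 0" "a ^ k = 1" using torsion by blast
  then obtain m where m: "m > 0" "a ^ m = 1" "\<And>i. 0 < i \<Longrightarrow> i < m \<Longrightarrow> a ^ i \<noteq> 1" "(of_nat m :: 'a) \<noteq> 0"
    using finite_order_obtain[OF p] by blast
  obtain w j where w: "w \<noteq> 0" "w * a = a ^ j * w" "a ^ j \<noteq> a"
    using twisted_commutation[OF m ay] by blast
  obtain q where q: "q > 0" "w ^ q = 1" using torsion[OF w(1)] by blast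
  define r where "r = (LEAST r. r > 0 \<and> w ^ r * a = a * w ^ r)"
  have r: "r > 0" "w ^ r * a = a * w ^ r"
    using LeastI[of "\<lambda>r. r > 0 \<and> w ^ r * a = a * w ^ r" q] q unfolding r_def by auto
  have free: "w ^ i * a \<noteq> a * w ^ i" if "0 < i" "i < r" for i
    using not_less_Least[of i "\<lambda>r. r > 0 \<and> w ^ r * a = a * w ^ r"] that unfolding r_def by auto
  have "r \<noteq> 1" using r(2) w by auto
  with r(1) have r2: "2 \<le> r" by simp
  define b where "b = w ^ r"
  have bq: "b ^ q = 1" unfolding b_def using q(2) by (metis mult.commute power_mult power_one)
  have ba: "b ^ l * a ^ i = a ^ i * b ^ l" for i l
    using r(2) by (metis b_def power_commuting_commutes)
  define G where "G = (\<lambda>(i, l). a ^ i * b ^ l) ` ({..<m} \<times> {..<q})"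
  have G_I: "a ^ i * b ^ l \<in> G" for i l
  proof -
    have reduce: "x ^ (i mod k) = x ^ i" if "x ^ k = 1" for x :: 'a and i k
    proof -
      have "x ^ i = x ^ (k * (i div k) + i mod k)" by simp
      then show ?thesis using that by (simp only: power_add power_mult) simp
    qed
    have "a ^ i * b ^ l = (\<lambda>(i, l). a ^ i * b ^ l) (i mod m, l mod q)"
      by (simp add: reduce[OF m(2)] reduce[OF bq])
    then show ?thesis unfolding G_def by (rule image_eqI) (use m(1) q(1) in simp)
  qed
  have G_E: "\<exists>i l. g = a ^ i * b ^ l" if "g \<in> G" for g
    using that by (auto simp: G_def)
  have fin_G: "finite G" by (simp add: G_def)
  have G_prod: "(a ^ i * b ^ l) * (a ^ i' * b ^ l') = a ^ (i + i') * b ^ (l + l')" for i l i' l'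
  proof -
    have "(a ^ i * b ^ l) * (a ^ i' * b ^ l') = a ^ i * (b ^ l * a ^ i') * b ^ l'"
      by (simp only: mult.assoc)
    then show ?thesis by (simp add: ba power_add mult.assoc)
  qed
  have G_mult: "g * h \<in> G" if "g \<in> G" "h \<in> G" for g h
    using G_E[OF that(1)] G_E[OF that(2)] G_prod G_I by metis
  have G_comm: "g * h = h * g" if "g \<in> G" "h \<in> G" for g h
    using G_E[OF that(1)] G_E[OF that(2)] G_prod by (metis add.commute)
  note fin_F = finite_nat_span[OF p fin_G]
  have F1: "1 \<in> nat_span G" using nat_span_base[OF fin_G G_I[of 0 0]] by simp
  have conj: "w * x * inverse w \<in> nat_span G" if "x \<in> nat_span G" for x
    using that
  proof (induction x rule: nat_span_induct)
    case (base g)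
    then obtain i l where g: "g = a ^ i * b ^ l" using G_E by blast
    have wa: "w * a ^ i = a ^ (j * i) * w" for i
    proof (induction i)
      case (Suc i)
      have "w * a ^ Suc i = (w * a) * a ^ i" by (simp add: mult.assoc)
      also have "\<dots> = a ^ j * (w * a ^ i)" by (simp add: w(2) mult.assoc)
      also have "\<dots> = a ^ (j * Suc i) * w" by (simp add: Suc.IH power_add mult.assoc)
      finally show ?case .
    qed simp
    have wb: "w * b ^ l = b ^ l * w"
      by (simp add: b_def power_commutes flip: power_mult)
    have "w * g * inverse w = w * a ^ i * b ^ l * inverse w"
      by (simp only: g mult.assoc)
    also have "\<dots> = a ^ (j * i) * (w * b ^ l) * inverse w" by (simp only: wa mult.assoc)
    also have "\<dots> = a ^ (j * i) * b ^ l" unfolding wb using w(1) by (simp add: mult.assoc)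
    finally have "w * g * inverse w = a ^ (j * i) * b ^ l" .
    then show ?case using nat_span_base[OF fin_G G_I] by simp
  qed (simp_all add: nat_span_0 nat_span_add distrib_left distrib_right)
  show False
  proof (rule no_finite_cyclic_extension[OF fin_F nat_span_0 F1 nat_span_add
        nat_span_mult[OF fin_G G_mult] _ nat_span_commute[OF G_comm] w(1) conj r2 _ _ m(2,4) free])
    show "inverse x \<in> nat_span G" if "x \<in> nat_span G" for x
      using finite_mult_closed_inverse[OF fin_F nat_span_0 F1 nat_span_mult[OF fin_G G_mult] that] .
    show "w ^ r \<in> nat_span G" using nat_span_base[OF fin_G G_I[of 0 1]] by (simp add: b_def)
    show "a \<in> nat_span G" using nat_span_base[OF fin_G G_I[of 1 0]] by simp
  qed
qed

text \<open>A relation whose leading coefficient is nonzero keeps all powers of \<open>t\<close> inside the span of finitely many of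
them over the centre, a finite set. Then two powers of \<open>t\<close> coincide.\<close>

lemma power_independent_of_infinite_order:
  fixes t :: "'a::division_ring"
  assumes fin: "finite {z::'a. central z}" and t: "t \<noteq> 0" "\<And>k. k > 0 \<Longrightarrow> t ^ k \<noteq> 1"
  shows "power_independent t"
  unfolding power_independent_def
proof (intro allI impI)
  fix s :: nat and b :: "nat \<Rightarrow> 'a" and i
  assume "\<forall>i\<le>s. central (b i)" "(\<Sum>i\<le>s. t ^ i * b i) = 0" "i \<le> s"
  then show "b i = 0"
  proof (induction s arbitrary: i)
    case (Suc s)
    have last: "b (Suc s) = 0"
    proof (rule ccontr)
      assume nz: "b (Suc s) \<noteq> 0"
      define V where "V = (\<lambda>c. \<Sum>i\<le>s. t ^ i * c i) ` (\<Pi>\<^sub>E i\<in>{..s}. {z. central z})"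
      have "finite V" unfolding V_def using fin by (intro finite_imageI finite_PiE) auto
      have V_I: "(\<Sum>i\<le>s. t ^ i * c i) \<in> V" if "\<And>i. i \<le> s \<Longrightarrow> central (c i)" for c
      proof -
        have "(\<Sum>i\<le>s. t ^ i * c i) = (\<Sum>i\<le>s. t ^ i * restrict c {..s} i)" by simp
        then show ?thesis
          unfolding V_def by (rule image_eqI[of _ _ "restrict c {..s}"]) (use that in auto)
      qed
      define e where "e = - inverse (b (Suc s))"
      define c where "c i = b i * e" for i
      have "central e"
        using central_diff[OF central_0 central_inverse[of "b (Suc s)"]] Suc.prems(1) by (simp add: e_def)
      then have c: "central (c i)" if "i \<le> Suc s" for i
        using Suc.prems(1) that by (simp add: c_def central_mult)
      have top: "t ^ Suc s = (\<Sum>i\<le>s. t ^ i * c i)"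
      proof -
        have "(\<Sum>i\<le>s. t ^ i * b i) = - (t ^ Suc s * b (Suc s))"
          using Suc.prems(2) by (simp add: eq_neg_iff_add_eq_0)
        moreover have "(\<Sum>i\<le>s. t ^ i * c i) = (\<Sum>i\<le>s. t ^ i * b i) * e"
          by (simp add: c_def sum_distrib_right mult.assoc)
        ultimately show ?thesis using nz by (simp add: e_def mult.assoc)
      qed
      have "t * x \<in> V" if x: "x \<in> V" for x
      proof -
        have "\<exists>d. x = (\<Sum>i\<le>s. t ^ i * d i) \<and> (\<forall>i\<le>s. central (d i))"
        proof -
          obtain d where "d \<in> (\<Pi>\<^sub>E i\<in>{..s}. {z. central z})" "x = (\<Sum>i\<le>s. t ^ i * d i)"
            using x unfolding V_def by blast
          moreover from this(1) have "central (d i)" if "i \<le> s" for i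
            using PiE_mem[of d "{..s}" "\<lambda>_. {z. central z}" i] that by simp
          ultimately show ?thesis by blast
        qed
        then obtain d where d: "x = (\<Sum>i\<le>s. t ^ i * d i)" "\<And>i. i \<le> s \<Longrightarrow> central (d i)"
          by blast
        let ?e = "\<lambda>i. (if i = 0 then 0 else d (i - 1)) + c i * d s"
        have "t * x = (\<Sum>i\<le>s. t ^ Suc i * d i)"
          by (simp add: d(1) sum_distrib_left mult.assoc)
        also have "\<dots> = (\<Sum>i\<le>Suc s. t ^ i * (if i = 0 then 0 else d (i - 1)))"
          by (subst sum.atMost_Suc_shift) simp
        also have "\<dots> = (\<Sum>i\<le>s. t ^ i * (if i = 0 then 0 else d (i - 1))) + t ^ Suc s * d s"
          by simp
        also have "t ^ Suc s * d s = (\<Sum>i\<le>s. t ^ i * (c i * d s))"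
          unfolding top by (simp add: sum_distrib_right mult.assoc)
        finally have "t * x = (\<Sum>i\<le>s. t ^ i * ?e i)"
          by (simp add: distrib_left sum.distrib)
        moreover have "central (?e i)" if "i \<le> s" for i
          using d(2) c that by (intro central_add central_mult) auto
        ultimately show ?thesis using V_I[of ?e] by simp
      qed
      moreover have "1 \<in> V"
        using V_I[of "\<lambda>i. if i = 0 then 1 else 0"] by (simp add: if_distrib cong: if_cong)
      ultimately have "t ^ k \<in> V" for k by (induction k) auto
      then have "\<not> inj (\<lambda>k. t ^ k)"
        using finite_imageD[of "\<lambda>k. t ^ k" UNIV] finite_subset[OF _ \<open>finite V\<close>, of "range (\<lambda>k. t ^ k)"]
        by auto
      then obtain k l where kl: "t ^ k = t ^ l" "k < l"
        unfolding inj_def by (metis linorder_neqE_nat)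
      then have "t ^ k * t ^ (l - k) = t ^ k * 1"
        by (metis le_add_diff_inverse less_imp_le mult_1_right power_add)
      then have "t ^ (l - k) = 1" using t(1) by simp
      with t(2)[of "l - k"] kl show False by simp
    qed
    then have "(\<Sum>i\<le>s. t ^ i * b i) = 0" using Suc.prems(2) by simp
    with Suc.IH Suc.prems(1,3) last show ?case by (auto simp: le_Suc_eq)
  qed simp
qed

section \<open>The reciprocal identity\<close>

text \<open>In the generic case \<open>x (1 + x w)\<close> has inverse \<open>x\<inverse> - (w\<inverse> + x)\<inverse>\<close>. Applying the hypothesis to this
element, to \<open>x\<close>, to \<open>w\<inverse>\<close> and to \<open>w\<inverse> + x\<close> gives the identity. The degenerate case \<open>x w = - 1\<close> is where
the parity of \<open>n\<close> matters.\<close>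

lemma reciprocal_identity:
  fixes f g :: "'a::division_ring \<Rightarrow> 'a"
  assumes f: "additive f" and g: "additive g" and n: "n > 0" "even n"
    and fg: "\<And>x. x \<noteq> 0 \<Longrightarrow> f x = x ^ n * g (inverse x)"
    and xw: "x * w = w * x"
  shows "f (x * x * w) = middle_terms n (x * w) * f x - x ^ n * g w"
proof -
  consider "x = 0" | "w = 0" | "x \<noteq> 0" "w \<noteq> 0" "1 + x * w = 0" | "x \<noteq> 0" "w \<noteq> 0" "1 + x * w \<noteq> 0"
    by blast
  then show ?thesis
  proof cases
    case 1 then show ?thesis using n by (simp add: additive.zero[OF f])
  next
    case 2 then show ?thesis using n by (simp add: additive.zero[OF f] additive.zero[OF g])
  next
    case 3
    then have xw1: "x * w = - 1" by (simp add: eq_neg_iff_add_eq_0 add.commute)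
    then have "w = - inverse x" using 3 by (metis inverse_unique minus_mult_minus minus_mult_right minus_minus mult_minus_left)
    then have "x ^ n * g w = - f x" using fg[of x] 3 by (simp add: additive.minus[OF g])
    moreover have "f (x * x * w) = - f x"
      using xw1 by (simp add: mult.assoc additive.minus[OF f])
    ultimately show ?thesis using xw1 n by (simp add: power_0_left mult_2)
  next
    case 4
    let ?u = "1 + x * w" and ?v = "inverse w + x"
    have xu: "x * ?u = ?u * x" using xw by (simp add: algebra_simps mult.assoc) (metis mult.assoc)
    have v: "?v = ?u * inverse w" using 4 by (simp add: distrib_right mult.assoc)
    have wv: "w * ?v = ?u" "?v * w = ?u" using 4 xw by (simp_all add: distrib_left distrib_right)
    have v0: "?v \<noteq> 0" using v 4 by simp
    have xwv: "(x * w) * ?v = x * ?u" "?v * (x * w) = x * ?u"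
    proof -
      show "(x * w) * ?v = x * ?u" by (simp only: mult.assoc wv)
      have "?v * (x * w) = (?v * w) * x" using xw by (simp only: mult.assoc)
      then show "?v * (x * w) = x * ?u" by (simp only: wv xu)
    qed
    have inv: "inverse (x * ?u) = inverse x - inverse ?v"
    proof (rule inverse_unique)
      have "x * ?u * inverse x = ?u" using xu 4 by (simp add: mult.assoc)
      moreover have "x * ?u * inverse ?v = x * w" unfolding xwv(1)[symmetric] using v0 by (simp add: mult.assoc)
      ultimately show "x * ?u * (inverse x - inverse ?v) = 1" by (simp add: right_diff_distrib)
    qed
    have "f (x * ?u) = (x * ?u) ^ n * g (inverse x) - (x * ?u) ^ n * g (inverse ?v)"
      using fg[of "x * ?u"] 4 unfolding inv by (simp add: additive.diff[OF g] right_diff_distrib)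
    also have "(x * ?u) ^ n * g (inverse x) = ?u ^ n * f x"
      using power_mult_commuting[OF xu[symmetric], of n] fg[of x] 4 by (simp add: xu mult.assoc)
    also have "(x * ?u) ^ n * g (inverse ?v) = (x * w) ^ n * f ?v"
    proof -
      have "(x * ?u) ^ n = (x * w) ^ n * ?v ^ n"
        by (subst power_mult_commuting[symmetric]) (simp_all only: xwv)
      then show ?thesis by (simp only: fg[OF v0] mult.assoc)
    qed
    also have "\<dots> = (x * w) ^ n * f (inverse w) + (x * w) ^ n * f x"
      by (simp only: additive.add[OF f] distrib_left)
    also have "(x * w) ^ n * f (inverse w) = x ^ n * g w"
    proof -
      have "w ^ n * (inverse w ^ n * g w) = g w"
        using 4 by (simp add: power_inverse flip: mult.assoc)
      then show ?thesis
        using fg[of "inverse w"] 4 by (simp add: power_mult_commuting[OF xw] mult.assoc)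
    qed
    also have "f (x * ?u) = f x + f (x * x * w)"
      by (simp add: distrib_left additive.add[OF f] mult.assoc)
    finally show ?thesis by (simp add: algebra_simps)
  qed
qed

theorem theoremB:
  fixes f g :: "'a::division_ring \<Rightarrow> 'a" and n :: nat
  assumes noncomm: "\<exists>a b :: 'a. a * b \<noteq> b * a"
    and char: "CHAR('a) \<noteq> 2"
    and f: "additive f"
    and g: "additive g"
    and n: "n > 0" "n \<noteq> 2"
    and fg: "\<forall>x. x \<noteq> 0 \<longrightarrow> f x = x ^ n * g (inverse x)"
  shows "f = (\<lambda>_. 0) \<and> g = (\<lambda>_. 0)"
proof -
  have two: "(2::'a) \<noteq> 0"
  proof
    assume "(2::'a) = 0"
    then have d: "CHAR('a) dvd 2" using of_nat_eq_0_iff_char_dvd[of 2, where ?'a = 'a] by simp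
    then have "CHAR('a) \<le> 2" by (rule dvd_imp_le) simp
    moreover have "CHAR('a) \<noteq> 0" using d by (metis dvd_0_left_iff zero_neq_numeral)
    ultimately show False using char CHAR_not_1[where ?'a = 'a] by linarith
  qed
  have double: "x = 0" if "x = - x" for x :: 'a
  proof -
    have "2 * x = 0" using that by (simp add: mult_2 eq_neg_iff_add_eq_0)
    with two show ?thesis by simp
  qed
  have f_eq: "f x = x ^ n * g (inverse x)" if "x \<noteq> 0" for x using fg that by blast
  have g_eq: "g x = x ^ n * f (inverse x)" if "x \<noteq> 0" for x
    using f_eq[of "inverse x"] that by (simp add: power_inverse flip: mult.assoc)
  have f_zero: "\<forall>x. f x = 0"
  proof (cases "even n")
    case False
    have "f x = 0" for x
    proof (cases "x = 0")
      case nz: False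
      have "- f x = (- x) ^ n * g (inverse (- x))"
        using f_eq[of "- x"] nz by (simp add: additive.minus[OF f])
      also have "\<dots> = f x" using f_eq[OF nz] False by (simp add: additive.minus[OF g])
      finally show ?thesis using double[of "f x"] by simp
    qed (simp add: additive.zero[OF f])
    then show ?thesis by blast
  next
    case True
    with n have n2: "n > 2" by (metis One_nat_def Suc_lessI even_Suc numeral_2_eq_2 odd_one)
    obtain k where k: "2 \<le> k" "k < n" "(of_nat (n choose k) :: 'a) \<noteq> 0"
      using exists_middle_binomial_nonzero[OF True n2 two] by blast
    have identity: "f (x * x * w) = middle_terms n (x * w) * f x - x ^ n * g w"
      if "x * w = w * x" for x w
      by (rule reciprocal_identity[OF f g n(1) True _ that]) (rule f_eq)
    have dichotomy: "infinite {z::'a. central z} \<or> (\<exists>t::'a. power_independent t)"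
      using exists_infinite_order[OF _ noncomm] power_independent_of_infinite_order by blast
    have T: "\<not> additive (middle_terms n :: 'a \<Rightarrow> 'a)"
      using dichotomy middle_terms_not_additive_of_infinite_center[OF _ noncomm k]
        middle_terms_not_additive_of_power_independent[OF _ k] by blast
    have f1: "f 1 = 0"
    proof (rule ccontr)
      assume nz: "f 1 \<noteq> 0"
      have "middle_terms n w = (f w + g w) * inverse (f 1)" for w
        using identity[of 1 w] nz by (simp add: mult.assoc)
      then have T_eq: "middle_terms n = (\<lambda>w. (f w + g w) * inverse (f 1))" by (rule ext)
      have "additive (middle_terms n :: 'a \<Rightarrow> 'a)"
        unfolding T_eq by (simp add: additive_def additive.add[OF f] additive.add[OF g] algebra_simps)
      with T show False ..
    qed
    have gf: "g w = - f w" for w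
      using identity[of 1 w] f1 by (simp add: eq_neg_iff_add_eq_0 add.commute)
    have id: "f (x * x * w) = middle_terms n (x * w) * f x + x ^ n * f w" if "x * w = w * x" for x w
      using identity[OF that] by (simp add: gf)
    from dichotomy show ?thesis
    proof
      assume "infinite {z::'a. central z}"
      from additive_eq_0_of_infinite_center[OF this two k T f id] show ?thesis by blast
    next
      assume "\<exists>t::'a. power_independent t"
      then obtain t :: 'a where "power_independent t" ..
      moreover have "f (x * x) = middle_terms n x * f x" for x
        using id[of x 1] f1 by simp
      ultimately show ?thesis using additive_square_eq_0_of_power_independent[OF _ k f] by blast
    qed
  qed
  moreover have "g x = 0" for x
    using g_eq[of x] f_zero additive.zero[OF g] by (cases "x = 0") simp_all
  ultimately show ?thesis by auto
qed

end
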